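(* Let $\alpha$ be a twisted partial action of a group $G$ on a unital ring $R$ such that every ideal $D_g$ is generated by a central idempotent $1_g$. Suppose that $G$ is abelian and that the centralizer $C_{R*_{\alpha}^{w}G}(R)$ of $R$ in the partial crossed product $R*_{\alpha}^{w}G$ is simple. Then $R*_{\alpha}^{w}G$ is simple if and only if $R$ is $\alpha$-simple.
   Context: $G$ is a group with identity $e$ and $R$ is an associative ring with identity $1_R$. A twisted partial action of $G$ on $R$ is a triple $\alpha=(\{D_g\}_{g\in G},\{\alpha_g\}_{g\in G},\{w_{g,h}\}_{(g,h)\in G\times G})$ where each $D_g$ is a two-sided ideal of $R$, $\alpha_g:D_{g^{-1}}\to D_g$ is a ring isomorphism, and $w_{g,h}$ is an invertible element of the multiplier ring of $D_gD_{gh}$, such that for all $g,h,t\in G$: (i) $D_g^2=D_g$ and $D_gD_h=D_hD_g$; (ii) $D_e=R$ and $\alpha_e=\mathrm{id}_R$; (iii) $\alpha_g(D_{g^{-1}}D_h)=D_gD_{gh}$; (iv) $\alpha_g\circ\alpha_h(a)=w_{g,h}\alpha_{gh}(a)w_{g,h}^{-1}$ for all $a\in D_{h^{-1}}D_{h^{-1}g^{-1}}$; (v) $w_{g,e}=w_{e,g}=1$ (the identity multiplier); (vi) $\alpha_g(aw_{h,t})w_{g,ht}=\alpha_g(a)w_{g,h}w_{gh,t}$ for all $a\in D_{g^{-1}}D_hD_{ht}$. Standing assumption: each $D_g$ is generated by an idempotent $1_g$ that is central in $R$. Hence $D_gD_{gh}$ is a unital ring with identity $1_g1_{gh}$, $w_{g,h}$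 is identified with an invertible element of the ring $D_gD_{gh}$, and $w_{g,e}=w_{e,g}=1_g$. The partial crossed product $R*_{\alpha}^{w}G$ is $\bigoplus_{g\in G}D_g\delta_g$ (the $\delta_g$ are symbols) with the usual addition and multiplication $(a_g\delta_g)(b_h\delta_h)=\alpha_g(\alpha_g^{-1}(a_g)b_h)w_{g,h}\delta_{gh}$; it is an associative ring with identity $1_R\delta_e$, and $R$ is identified with $R\delta_e$. For a subset $Y$ of a ring $S$, $C_S(Y)=\{s\in S: sy=ys\ \forall y\in Y\}$. An ideal $I$ of $R$ is $\alpha$-invariant if $\alpha_g(I\cap D_{g^{-1}})\subseteq I\cap D_g$ for all $g\in G$. $R$ is $\alpha$-simple if its only $\alpha$-invariant (two-sided) ideals are the trivial ones, $\{0\}$ and $R$. *)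

theory Defs
  imports "HOL-Algebra.Algebra"
begin

text \<open>
  Each \<open>D g\<close> is generated by a central idempotent \<open>u g\<close> (written \<open>1\<^sub>g\<close> on paper), so \<open>D g \<cdot> D (g h)\<close>
  is a ring with identity \<open>u g \<otimes> u (g h)\<close>, and its multiplier ring is identified with the ring
  itself: an invertible multiplier is a unit \<open>w g h\<close> of that ring, and the identity multiplier of
  \<open>D g\<close> is \<open>u g\<close>.  The map \<open>\<alpha> g\<close> is only meaningful on \<open>D g\<inverse>\<close>.
\<close>

definition ideal_ring :: "('a, 'm) ring_scheme \<Rightarrow> 'a set \<Rightarrow> 'a \<Rightarrow> ('a, 'm) ring_scheme"
  where "ideal_ring R I c = R\<lparr>carrier := I, one := c\<rparr>"

locale twisted_partial_action = G: group G + R: ring R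
  for G :: "('g, 'n) monoid_scheme" (structure)
    and R :: "('a, 'm) ring_scheme" (structure) +
  fixes D :: "'g \<Rightarrow> 'a set"
    and u :: "'g \<Rightarrow> 'a"
    and \<alpha> :: "'g \<Rightarrow> 'a \<Rightarrow> 'a"
    and w :: "'g \<Rightarrow> 'g \<Rightarrow> 'a"
  assumes u_closed: "g \<in> carrier G \<Longrightarrow> u g \<in> carrier R"
    and u_idem: "g \<in> carrier G \<Longrightarrow> u g \<otimes>\<^bsub>R\<^esub> u g = u g"
    and u_central: "\<lbrakk>g \<in> carrier G; r \<in> carrier R\<rbrakk> \<Longrightarrow> u g \<otimes>\<^bsub>R\<^esub> r = r \<otimes>\<^bsub>R\<^esub> u g"
    and D_generated: "g \<in> carrier G \<Longrightarrow> D g = Idl\<^bsub>R\<^esub> {u g}"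
    and \<alpha>_iso: "g \<in> carrier G \<Longrightarrow>
      \<alpha> g \<in> ring_iso (ideal_ring R (D (inv\<^bsub>G\<^esub> g)) (u (inv\<^bsub>G\<^esub> g))) (ideal_ring R (D g) (u g))"
    and w_unit: "\<lbrakk>g \<in> carrier G; h \<in> carrier G\<rbrakk> \<Longrightarrow>
      w g h \<in> Units (ideal_ring R (D g \<cdot>\<^bsub>R\<^esub> D (g \<otimes>\<^bsub>G\<^esub> h)) (u g \<otimes>\<^bsub>R\<^esub> u (g \<otimes>\<^bsub>G\<^esub> h)))"
    and D_square: "g \<in> carrier G \<Longrightarrow> D g \<cdot>\<^bsub>R\<^esub> D g = D g"
    and D_commute: "\<lbrakk>g \<in> carrier G; h \<in> carrier G\<rbrakk> \<Longrightarrow> D g \<cdot>\<^bsub>R\<^esub> D h = D h \<cdot>\<^bsub>R\<^esub> D g"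
    and D_one: "D \<one>\<^bsub>G\<^esub> = carrier R"
    and \<alpha>_one: "r \<in> carrier R \<Longrightarrow> \<alpha> \<one>\<^bsub>G\<^esub> r = r"
    and \<alpha>_image: "\<lbrakk>g \<in> carrier G; h \<in> carrier G\<rbrakk> \<Longrightarrow>
      \<alpha> g ` (D (inv\<^bsub>G\<^esub> g) \<cdot>\<^bsub>R\<^esub> D h) = D g \<cdot>\<^bsub>R\<^esub> D (g \<otimes>\<^bsub>G\<^esub> h)"
    and \<alpha>_comp: "\<lbrakk>g \<in> carrier G; h \<in> carrier G;
        a \<in> D (inv\<^bsub>G\<^esub> h) \<cdot>\<^bsub>R\<^esub> D (inv\<^bsub>G\<^esub> h \<otimes>\<^bsub>G\<^esub> inv\<^bsub>G\<^esub> g)\<rbrakk> \<Longrightarrow>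
      \<alpha> g (\<alpha> h a) = w g h \<otimes>\<^bsub>R\<^esub> \<alpha> (g \<otimes>\<^bsub>G\<^esub> h) a \<otimes>\<^bsub>R\<^esub>
        inv\<^bsub>ideal_ring R (D g \<cdot>\<^bsub>R\<^esub> D (g \<otimes>\<^bsub>G\<^esub> h)) (u g \<otimes>\<^bsub>R\<^esub> u (g \<otimes>\<^bsub>G\<^esub> h))\<^esub> (w g h)"
    and w_one_right: "g \<in> carrier G \<Longrightarrow> w g \<one>\<^bsub>G\<^esub> = u g"
    and w_one_left: "g \<in> carrier G \<Longrightarrow> w \<one>\<^bsub>G\<^esub> g = u g"
    and w_cocycle: "\<lbrakk>g \<in> carrier G; h \<in> carrier G; t \<in> carrier G;
        a \<in> D (inv\<^bsub>G\<^esub> g) \<cdot>\<^bsub>R\<^esub> D h \<cdot>\<^bsub>R\<^esub> D (h \<otimes>\<^bsub>G\<^esub> t)\<rbrakk> \<Longrightarrow>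
      \<alpha> g (a \<otimes>\<^bsub>R\<^esub> w h t) \<otimes>\<^bsub>R\<^esub> w g (h \<otimes>\<^bsub>G\<^esub> t) =
      \<alpha> g a \<otimes>\<^bsub>R\<^esub> w g h \<otimes>\<^bsub>R\<^esub> w (g \<otimes>\<^bsub>G\<^esub> h) t"

text \<open>
  The formal sum \<open>\<Sum>\<^sub>g a\<^sub>g \<delta>\<^sub>g\<close> is the finitely supported family \<open>(a\<^sub>g)\<^sub>g\<close> (extensional outside
  \<open>carrier G\<close>).  The coefficient of \<open>\<delta>\<^sub>k\<close> in a product sums \<open>\<alpha>\<^sub>g(\<alpha>\<^sub>g\<inverse>(x\<^sub>g) y\<^sub>h) w\<^sub>g\<^sub>,\<^sub>h\<close> over the finitely
  many pairs \<open>(g, h)\<close> in the supports with \<open>g h = k\<close>.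
\<close>

definition supp :: "('g, 'n) monoid_scheme \<Rightarrow> ('a, 'm) ring_scheme \<Rightarrow> ('g \<Rightarrow> 'a) \<Rightarrow> 'g set"
  where "supp G R x = {g \<in> carrier G. x g \<noteq> \<zero>\<^bsub>R\<^esub>}"

definition delta_one :: "('g, 'n) monoid_scheme \<Rightarrow> ('a, 'm) ring_scheme \<Rightarrow> 'a \<Rightarrow> 'g \<Rightarrow> 'a"
  where "delta_one G R r = (\<lambda>g\<in>carrier G. if g = \<one>\<^bsub>G\<^esub> then r else \<zero>\<^bsub>R\<^esub>)"

definition partial_crossed_product ::
  "('g, 'n) monoid_scheme \<Rightarrow> ('a, 'm) ring_scheme \<Rightarrow> ('g \<Rightarrow> 'a set) \<Rightarrow>
   ('g \<Rightarrow> 'a \<Rightarrow> 'a) \<Rightarrow> ('g \<Rightarrow> 'g \<Rightarrow> 'a) \<Rightarrow> ('g \<Rightarrow> 'a) ring"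
  where "partial_crossed_product G R D \<alpha> w =
    \<lparr>carrier = {x \<in> \<Pi>\<^sub>E g\<in>carrier G. D g. finite (supp G R x)},
     monoid.mult = (\<lambda>x y. \<lambda>k\<in>carrier G.
       finsum R (\<lambda>(g, h). \<alpha> g (inv_into (D (inv\<^bsub>G\<^esub> g)) (\<alpha> g) (x g) \<otimes>\<^bsub>R\<^esub> y h) \<otimes>\<^bsub>R\<^esub> w g h)
         {(g, h) \<in> supp G R x \<times> supp G R y. g \<otimes>\<^bsub>G\<^esub> h = k}),
     one = delta_one G R \<one>\<^bsub>R\<^esub>,
     ring.zero = delta_one G R \<zero>\<^bsub>R\<^esub>,
     add = (\<lambda>x y. \<lambda>g\<in>carrier G. x g \<oplus>\<^bsub>R\<^esub> y g)\<rparr>"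

definition centralizer :: "('a, 'm) ring_scheme \<Rightarrow> 'a set \<Rightarrow> 'a set"
  where "centralizer S Y = {s \<in> carrier S. \<forall>y\<in>Y. s \<otimes>\<^bsub>S\<^esub> y = y \<otimes>\<^bsub>S\<^esub> s}"

text \<open>
  \<^const>\<open>ideal\<close> already presupposes \<^const>\<open>ring\<close>; without the explicit conjunct \<open>ring S\<close> the condition
  on ideals would be vacuous for a structure that is not a ring.  The zero ring is not simple.
\<close>

definition simple_ring :: "('a, 'm) ring_scheme \<Rightarrow> bool"
  where "simple_ring S \<longleftrightarrow> ring S \<and> carrier S \<noteq> {\<zero>\<^bsub>S\<^esub>} \<and>
    (\<forall>I. ideal I S \<longrightarrow> I = {\<zero>\<^bsub>S\<^esub>} \<or> I = carrier S)"

definition invariant_ideal ::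
  "('g, 'n) monoid_scheme \<Rightarrow> ('a, 'm) ring_scheme \<Rightarrow> ('g \<Rightarrow> 'a set) \<Rightarrow> ('g \<Rightarrow> 'a \<Rightarrow> 'a) \<Rightarrow> 'a set \<Rightarrow> bool"
  where "invariant_ideal G R D \<alpha> I \<longleftrightarrow> ideal I R \<and>
    (\<forall>g\<in>carrier G. \<alpha> g ` (I \<inter> D (inv\<^bsub>G\<^esub> g)) \<subseteq> I \<inter> D g)"

definition alpha_simple ::
  "('g, 'n) monoid_scheme \<Rightarrow> ('a, 'm) ring_scheme \<Rightarrow> ('g \<Rightarrow> 'a set) \<Rightarrow> ('g \<Rightarrow> 'a \<Rightarrow> 'a) \<Rightarrow> bool"
  where "alpha_simple G R D \<alpha> \<longleftrightarrow>
    (\<forall>I. invariant_ideal G R D \<alpha> I \<longrightarrow> I = {\<zero>\<^bsub>R\<^esub>} \<or> I = carrier R)"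

end

theory Submission
  imports Defs
begin

text \<open>
  Write \<open>S\<close> for the crossed product.  An \<open>\<alpha>\<close>-invariant ideal \<open>I\<close> of \<open>R\<close> gives the ideal of \<open>S\<close> of all
  families with coefficients in \<open>I\<close>, so a simple \<open>S\<close> forces \<open>R\<close> to be \<open>\<alpha>\<close>-simple.  Conversely, let \<open>J\<close>
  be a nonzero ideal of \<open>S\<close>, choose \<open>y \<in> J\<close> nonzero with support \<open>T\<close> of minimal size and shift it so
  that the identity of \<open>G\<close> lies in \<open>T\<close>.  The identity coefficients of the elements of \<open>J\<close> supported in
  \<open>T\<close> form a nonzero ideal of \<open>R\<close>, which is \<open>\<alpha>\<close>-invariant because \<open>G\<close> is abelian.  Hence some such \<open>z\<close>
  has identity coefficient \<open>1\<close>; each \<open>z r - r z\<close> has smaller support and vanishes, so \<open>z\<close>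
  centralizes \<open>R\<close>.  Thus \<open>J\<close> meets the simple centralizer in a nonzero ideal and contains \<open>1\<close>.
\<close>

subsection \<open>The ideals \<open>D\<^sub>g\<close> and the maps \<open>\<alpha>\<^sub>g\<close>\<close>

context twisted_partial_action
begin

abbreviation rmult (infixl "\<star>" 70) where "a \<star> b \<equiv> a \<otimes>\<^bsub>R\<^esub> b"

definition \<beta> :: "'g \<Rightarrow> 'a \<Rightarrow> 'a" where "\<beta> g = inv_into (D (inv g)) (\<alpha> g)"

text \<open>The coefficient of \<open>\<delta>\<^sub>g\<^sub>h\<close> in the product of
  \<open>a \<delta>\<^sub>g\<close> and \<open>b \<delta>\<^sub>h\<close>. Isolating it lets
  associativity be settled on monomials first.\<close>

definition monomial_coeff :: "'g \<Rightarrow> 'g \<Rightarrow> 'a \<Rightarrow> 'a \<Rightarrow> 'a"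
  where "monomial_coeff g h a b = \<alpha> g (\<beta> g a \<star> b) \<star> w g h"

text \<open>As \<open>u g\<close> is a central idempotent, the elements it fixes form an ideal
  containing \<open>u g\<close>, hence containing \<open>D g\<close>; conversely
  \<open>x = x \<star> u g\<close> lies in \<open>D g\<close>. Membership in \<open>D g\<close> thus
  becomes an equation.\<close>

lemma D_eq:
  assumes g: "g \<in> carrier G"
  shows "D g = {x \<in> carrier R. x \<star> u g = x}"
proof
  let ?I = "{x \<in> carrier R. x \<star> u g = x}"
  have "ideal ?I R"
  proof (rule idealI)
    show "ring R" ..
    show "subgroup ?I (add_monoid R)"
    proof (rule R.add.subgroupI)
      show "?I \<noteq> {}" using u_closed[OF g] by (auto intro!: exI[of _ "\<zero>\<^bsub>R\<^esub>"])
    qed (use g u_closed in \<open>auto simp: R.l_distr R.l_minus\<close>)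
    fix a x assume a: "a \<in> ?I" and x: "x \<in> carrier R"
    show "x \<star> a \<in> ?I" using a x g u_closed by (auto simp: R.m_assoc)
    have "a \<star> x \<star> u g = a \<star> u g \<star> x"
      using a x u_closed[OF g] R.m_assoc[of a x "u g"] R.m_assoc[of a "u g" x] u_central[OF g x] by simp
    then show "a \<star> x \<in> ?I" using a x by auto
  qed
  moreover have "u g \<in> ?I" using g u_closed u_idem by auto
  ultimately show "D g \<subseteq> ?I" using D_generated[OF g] R.genideal_minimal by auto
  have I: "ideal (D g) R" using D_generated[OF g] u_closed[OF g] by (simp add: R.genideal_ideal)
  have "u g \<in> D g" using D_generated[OF g] u_closed[OF g] R.genideal_self' by simp
  then show "?I \<subseteq> D g" using ideal.I_l_closed[OF I] by force
qed

lemma D_ideal: "g \<in> carrier G \<Longrightarrow> ideal (D g) R"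
  using D_generated u_closed by (simp add: R.genideal_ideal)

lemma u_in_D: "g \<in> carrier G \<Longrightarrow> u g \<in> D g"
  by (simp add: D_eq u_closed u_idem)

lemma D_carrier: "g \<in> carrier G \<Longrightarrow> x \<in> D g \<Longrightarrow> x \<in> carrier R"
  by (simp add: D_eq)

lemma D_u_right: "g \<in> carrier G \<Longrightarrow> x \<in> D g \<Longrightarrow> x \<star> u g = x"
  by (simp add: D_eq)

lemma D_u_left: "g \<in> carrier G \<Longrightarrow> x \<in> D g \<Longrightarrow> u g \<star> x = x"
  by (simp add: D_eq u_central)

lemma D_mult_left: "g \<in> carrier G \<Longrightarrow> x \<in> D g \<Longrightarrow> r \<in> carrier R \<Longrightarrow> r \<star> x \<in> D g"
  using D_ideal ideal.I_l_closed by fast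

lemma D_mult_right: "g \<in> carrier G \<Longrightarrow> x \<in> D g \<Longrightarrow> r \<in> carrier R \<Longrightarrow> x \<star> r \<in> D g"
  using D_ideal ideal.I_r_closed by fast

lemma D_zero: "g \<in> carrier G \<Longrightarrow> \<zero>\<^bsub>R\<^esub> \<in> D g"
  by (simp add: D_eq u_closed)

lemma D_add: "g \<in> carrier G \<Longrightarrow> x \<in> D g \<Longrightarrow> y \<in> D g \<Longrightarrow> x \<oplus>\<^bsub>R\<^esub> y \<in> D g"
  by (simp add: D_eq u_closed R.l_distr)

lemma D_minus: "g \<in> carrier G \<Longrightarrow> x \<in> D g \<Longrightarrow> \<ominus>\<^bsub>R\<^esub> x \<in> D g"
  by (simp add: D_eq u_closed R.l_minus)

text \<open>An element \<open>x\<close> of the intersection is the product of \<open>x\<close> and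
  \<open>u h\<close>. Products of two ideals in the axioms can therefore be read as
  intersections.\<close>

lemma D_prod:
  assumes "g \<in> carrier G" "h \<in> carrier G"
  shows "D g \<cdot>\<^bsub>R\<^esub> D h = D g \<inter> D h"
proof
  show "D g \<cdot>\<^bsub>R\<^esub> D h \<subseteq> D g \<inter> D h" by (intro R.ideal_prod_inter D_ideal assms)
  show "D g \<inter> D h \<subseteq> D g \<cdot>\<^bsub>R\<^esub> D h"
  proof
    fix x assume x: "x \<in> D g \<inter> D h"
    then have "x \<star> u h \<in> D g \<cdot>\<^bsub>R\<^esub> D h"
      using assms u_in_D by (intro ideal_prod.prod) auto
    then show "x \<in> D g \<cdot>\<^bsub>R\<^esub> D h" using x assms D_u_right by simp
  qed
qed

text \<open>This inclusion supplies the membership premise of \<open>w_cocycle\<close>.\<close>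

lemma D_prod3:
  assumes "g \<in> carrier G" "h \<in> carrier G" "t \<in> carrier G"
  shows "D g \<inter> D h \<inter> D t \<subseteq> D g \<cdot>\<^bsub>R\<^esub> D h \<cdot>\<^bsub>R\<^esub> D t"
proof
  fix x assume x: "x \<in> D g \<inter> D h \<inter> D t"
  then have "x \<star> u t \<in> D g \<cdot>\<^bsub>R\<^esub> D h \<cdot>\<^bsub>R\<^esub> D t"
    using assms u_in_D D_prod by (intro ideal_prod.prod) auto
  then show "x \<in> D g \<cdot>\<^bsub>R\<^esub> D h \<cdot>\<^bsub>R\<^esub> D t" using x assms D_u_right by simp
qed

lemma u_one: "u \<one> = \<one>\<^bsub>R\<^esub>"
  using D_u_left[of \<one> "\<one>\<^bsub>R\<^esub>"] D_one u_closed by simp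

section \<open>The maps \<open>\<alpha> g\<close> and their inverses
  \<open>\<beta> g\<close>\<close>

lemma \<alpha>_bij: "g \<in> carrier G \<Longrightarrow> bij_betw (\<alpha> g) (D (inv g)) (D g)"
  using \<alpha>_iso by (simp add: ring_iso_def ideal_ring_def)

lemma \<alpha>_closed: "g \<in> carrier G \<Longrightarrow> x \<in> D (inv g) \<Longrightarrow> \<alpha> g x \<in> D g"
  using \<alpha>_bij bij_betwE by blast

lemma \<alpha>_inj: "\<lbrakk>g \<in> carrier G; x \<in> D (inv g); y \<in> D (inv g); \<alpha> g x = \<alpha> g y\<rbrakk> \<Longrightarrow> x = y"
  using \<alpha>_bij by (meson bij_betw_def inj_onD)

lemma \<alpha>_add: "\<lbrakk>g \<in> carrier G; x \<in> D (inv g); y \<in> D (inv g)\<rbrakk> \<Longrightarrow> \<alpha> g (x \<oplus>\<^bsub>R\<^esub> y) = \<alpha> g x \<oplus>\<^bsub>R\<^esub> \<alpha> g y"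
  using \<alpha>_iso by (simp add: ring_iso_def ideal_ring_def ring_hom_def)

lemma \<alpha>_mult: "\<lbrakk>g \<in> carrier G; x \<in> D (inv g); y \<in> D (inv g)\<rbrakk> \<Longrightarrow> \<alpha> g (x \<star> y) = \<alpha> g x \<star> \<alpha> g y"
  using \<alpha>_iso by (simp add: ring_iso_def ideal_ring_def ring_hom_def)

lemma \<alpha>_zero:
  assumes "g \<in> carrier G"
  shows "\<alpha> g \<zero>\<^bsub>R\<^esub> = \<zero>\<^bsub>R\<^esub>"
  using \<alpha>_add[of g "\<zero>\<^bsub>R\<^esub>" "\<zero>\<^bsub>R\<^esub>"] assms D_zero \<alpha>_closed D_carrier
  by (metis G.inv_closed R.r_zero R.add.l_cancel_one R.zero_closed)

lemma \<beta>_closed: "g \<in> carrier G \<Longrightarrow> x \<in> D g \<Longrightarrow> \<beta> g x \<in> D (inv g)"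
  using \<alpha>_bij unfolding \<beta>_def by (metis bij_betw_def inv_into_into)

lemma \<alpha>_\<beta>: "g \<in> carrier G \<Longrightarrow> x \<in> D g \<Longrightarrow> \<alpha> g (\<beta> g x) = x"
  using \<alpha>_bij unfolding \<beta>_def by (metis bij_betw_inv_into_right)

lemma \<beta>_\<alpha>: "g \<in> carrier G \<Longrightarrow> x \<in> D (inv g) \<Longrightarrow> \<beta> g (\<alpha> g x) = x"
  using \<alpha>_bij unfolding \<beta>_def by (metis bij_betw_inv_into_left)

lemma \<beta>_add:
  assumes "g \<in> carrier G" "x \<in> D g" "y \<in> D g"
  shows "\<beta> g (x \<oplus>\<^bsub>R\<^esub> y) = \<beta> g x \<oplus>\<^bsub>R\<^esub> \<beta> g y"
  by (rule \<alpha>_inj[of g]) (use assms in \<open>simp_all add: \<alpha>_add \<alpha>_\<beta> \<beta>_closed D_add\<close>)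

lemma \<beta>_zero: "g \<in> carrier G \<Longrightarrow> \<beta> g \<zero>\<^bsub>R\<^esub> = \<zero>\<^bsub>R\<^esub>"
  by (metis \<beta>_\<alpha> \<alpha>_zero D_zero G.inv_closed)

lemma \<alpha>_u: "g \<in> carrier G \<Longrightarrow> \<alpha> g (u (inv g)) = u g"
  using \<alpha>_iso by (simp add: ring_iso_def ideal_ring_def ring_hom_def)

lemma \<beta>_u: "g \<in> carrier G \<Longrightarrow> \<beta> g (u g) = u (inv g)"
  by (metis \<alpha>_u \<beta>_\<alpha> G.inv_closed u_in_D)

lemma \<alpha>_image_inter:
  "g \<in> carrier G \<Longrightarrow> h \<in> carrier G \<Longrightarrow> \<alpha> g ` (D (inv g) \<inter> D h) = D g \<inter> D (g \<otimes> h)"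
  using \<alpha>_image[of g h] by (simp add: D_prod)

text \<open>Both sides are the identity of \<open>D g \<inter> D (g \<otimes> h)\<close>: the map
  \<open>\<alpha> g\<close> sends \<open>D (inv g) \<inter> D h\<close>, a ring with identity
  \<open>u (inv g) \<star> u h\<close>, multiplicatively onto it.\<close>

lemma \<alpha>_u_u:
  assumes g: "g \<in> carrier G" and h: "h \<in> carrier G"
  shows "\<alpha> g (u (inv g) \<star> u h) = u g \<star> u (g \<otimes> h)"
proof -
  let ?e = "u (inv g) \<star> u h" and ?f = "u g \<star> u (g \<otimes> h)"
  have e: "?e \<in> D (inv g) \<inter> D h" and f: "?f \<in> D g \<inter> D (g \<otimes> h)"
    using g h by (simp_all add: D_mult_left D_mult_right u_in_D u_closed)
  have ae: "\<alpha> g ?e \<in> D g \<inter> D (g \<otimes> h)" using \<alpha>_image_inter[OF g h] e by blast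
  obtain s where s: "s \<in> D (inv g) \<inter> D h" "\<alpha> g s = ?f"
    using \<alpha>_image_inter[OF g h] f by (metis (no_types, lifting) imageE)
  have "s \<star> ?e = s" using s g h
    by (metis D_carrier D_u_right G.inv_closed Int_iff R.m_assoc u_closed)
  then have "?f = ?f \<star> \<alpha> g ?e" using s e \<alpha>_mult[of g s ?e] g by auto
  also have "\<dots> = \<alpha> g ?e" using ae g h D_carrier D_u_left u_closed
    by (metis G.m_closed Int_iff R.m_assoc)
  finally show ?thesis by simp
qed

subsection \<open>Associativity on monomials\<close>

text \<open>This is \<open>w\<^sub>g\<^sub>,\<^sub>h\<inverse>\<close>. The inverse is taken in the
  ring \<open>D g \<inter> D (g \<otimes> h)\<close>, so the product with \<open>w g h\<close> is
  \<open>u g \<star> u (g \<otimes> h)\<close> rather than the identity of \<open>R\<close>.\<close>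

definition v :: "'g \<Rightarrow> 'g \<Rightarrow> 'a"
  where "v g h = inv\<^bsub>ideal_ring R (D g \<cdot>\<^bsub>R\<^esub> D (g \<otimes> h)) (u g \<star> u (g \<otimes> h))\<^esub> (w g h)"

lemma w_props:
  assumes g: "g \<in> carrier G" and h: "h \<in> carrier G"
  shows "w g h \<in> D g" "w g h \<in> D (g \<otimes> h)" "v g h \<in> D g" "v g h \<in> D (g \<otimes> h)"
    "v g h \<star> w g h = u g \<star> u (g \<otimes> h)" "w g h \<star> v g h = u g \<star> u (g \<otimes> h)"
proof -
  let ?A = "ideal_ring R (D g \<cdot>\<^bsub>R\<^esub> D (g \<otimes> h)) (u g \<star> u (g \<otimes> h))"
  have gh: "g \<otimes> h \<in> carrier G" using g h by simp
  \<comment> \<open>The inverse laws for units become available once the ideal with identity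
    \<open>u g \<star> u (g \<otimes> h)\<close> is known to be a monoid.\<close>
  have "Group.monoid ?A"
  proof (rule monoidI, goal_cases)
    case (1 x y)
    then have "x \<in> D g \<inter> D (g \<otimes> h)" "y \<in> D g \<inter> D (g \<otimes> h)"
      using g gh by (simp_all add: ideal_ring_def D_prod)
    then show ?case
      using g gh by (simp add: ideal_ring_def D_prod D_mult_left D_carrier[of g])
  next
    case 2 show ?case
      using g gh by (simp add: ideal_ring_def D_prod D_mult_left D_mult_right u_in_D u_closed)
  next
    case 3 then show ?case
      using g gh by (simp add: ideal_ring_def D_prod R.m_assoc D_carrier[of g])
  next
    case (4 x) then show ?case
      using g gh by (simp add: ideal_ring_def D_prod R.m_assoc D_carrier[of g] u_closed D_u_left)
  next
    case (5 x) then show ?case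
      using g gh by (simp add: ideal_ring_def D_prod D_u_right D_carrier[of g] u_closed flip: R.m_assoc)
  qed
  then interpret A: Group.monoid ?A .
  have w: "w g h \<in> Units ?A" by (rule w_unit[OF g h])
  show "w g h \<in> D g" "w g h \<in> D (g \<otimes> h)"
    using A.Units_closed[OF w] g gh by (auto simp: ideal_ring_def D_prod)
  show "v g h \<in> D g" "v g h \<in> D (g \<otimes> h)"
    using A.Units_inv_closed[OF w] g gh by (auto simp: ideal_ring_def D_prod v_def)
  show "v g h \<star> w g h = u g \<star> u (g \<otimes> h)"
    using A.Units_l_inv[OF w] by (simp add: v_def ideal_ring_def)
  show "w g h \<star> v g h = u g \<star> u (g \<otimes> h)"
    using A.Units_r_inv[OF w] by (simp add: v_def ideal_ring_def)
qed

text \<open>This is \<open>\<alpha>_comp\<close> with the inverse of \<open>w g h\<close> cleared.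
  Multiplying by \<open>w g h\<close> on the right leaves the factor
  \<open>u g \<star> u (g \<otimes> h)\<close>, which fixes
  \<open>\<alpha> (g \<otimes> h) x\<close>, an element of both \<open>D g\<close> and
  \<open>D (g \<otimes> h)\<close>.\<close>

lemma \<alpha>_comp_w:
  assumes g: "g \<in> carrier G" and h: "h \<in> carrier G"
    and x: "x \<in> D (inv h)" "x \<in> D (inv h \<otimes> inv g)"
  shows "\<alpha> g (\<alpha> h x) \<star> w g h = w g h \<star> \<alpha> (g \<otimes> h) x"
proof -
  have gh: "g \<otimes> h \<in> carrier G" using g h by simp
  let ?y = "\<alpha> (g \<otimes> h) x"
  have "x \<in> D (inv (g \<otimes> h)) \<inter> D (inv h)" using x g h by (simp add: G.inv_mult_group)
  then have "?y \<in> D (g \<otimes> h) \<inter> D (g \<otimes> h \<otimes> inv h)"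
    using \<alpha>_image_inter[of "g \<otimes> h" "inv h"] g h by blast
  then have y: "?y \<in> D (g \<otimes> h)" "?y \<in> D g" using g h by (auto simp: G.m_assoc)
  have w: "w g h \<in> carrier R" "v g h \<in> carrier R" "?y \<in> carrier R"
    using w_props[OF g h] y g D_carrier by blast+
  have "\<alpha> g (\<alpha> h x) = w g h \<star> ?y \<star> v g h"
    using \<alpha>_comp[OF g h] x g h by (simp add: D_prod v_def)
  then have "\<alpha> g (\<alpha> h x) \<star> w g h = w g h \<star> (?y \<star> (v g h \<star> w g h))"
    using w by (simp add: R.m_assoc)
  also have "?y \<star> (v g h \<star> w g h) = ?y"
    using w_props(5)[OF g h] y w g gh by (simp add: D_u_right u_closed flip: R.m_assoc)
  finally show ?thesis .
qed

text \<open>Both sides reduce to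
  \<open>\<alpha> g y \<star> w g h \<star> w (g \<otimes> h) t\<close>, where
  \<open>y = a' \<star> \<alpha> h (b' \<star> c)\<close> and \<open>a'\<close>, \<open>b'\<close>
  are the preimages of \<open>a\<close>, \<open>b\<close> under \<open>\<alpha> g\<close>,
  \<open>\<alpha> h\<close>. The left side uses \<open>\<alpha>_comp_w\<close>, the right side the
  cocycle identity.\<close>

lemma monomial_coeff_assoc:
  assumes g: "g \<in> carrier G" and h: "h \<in> carrier G" and t: "t \<in> carrier G"
    and a: "a \<in> D g" and b: "b \<in> D h" and c: "c \<in> D t"
  shows "monomial_coeff (g \<otimes> h) t (monomial_coeff g h a b) c =
    monomial_coeff g (h \<otimes> t) a (monomial_coeff h t b c)"
proof -
  have G: "g \<otimes> h \<in> carrier G" "h \<otimes> t \<in> carrier G" "inv g \<in> carrier G" "inv h \<in> carrier G"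
    "g \<otimes> (h \<otimes> t) \<in> carrier G" "inv h \<otimes> inv g \<in> carrier G"
    using g h t by auto
  have cancel: "h \<otimes> (inv h \<otimes> inv g) = inv g"
    using g h G(4) by (simp add: G.m_assoc[symmetric])
  have inv: "inv (g \<otimes> h) = inv h \<otimes> inv g" using g h by (simp add: G.inv_mult_group)
  define a' b' where "a' = \<beta> g a" and "b' = \<beta> h b"
  have a': "a' \<in> D (inv g)" "a' \<in> carrier R" "\<alpha> g a' = a" and b': "b' \<in> D (inv h)" "b' \<in> carrier R" "\<alpha> h b' = b"
    using a b g h \<beta>_closed \<alpha>_\<beta> D_carrier G unfolding a'_def b'_def by blast+
  have bc: "b \<in> carrier R" "c \<in> carrier R" using b c h t D_carrier by auto
  have u: "u h \<in> carrier R" "u g \<in> carrier R" "u (h \<otimes> t) \<in> carrier R" "u (g \<otimes> (h \<otimes> t)) \<in> carrier R"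
     "u (inv g) \<in> carrier R"
    using u_closed G g h by auto
  note wgh = w_props[OF g h] and wht = w_props[OF h t] and wght = w_props[OF G(1) t]
  have W: "w g h \<in> carrier R" "w h t \<in> carrier R" "w (g \<otimes> h) t \<in> carrier R"
    using wgh wht wght g h G D_carrier by blast+
  \<comment> \<open>Cutting \<open>a'\<close> down to \<open>D h\<close> gives it a preimage
    \<open>p\<close> under \<open>\<alpha> h\<close>, so \<open>d = p \<star> b'\<close> is the
    preimage of \<open>a' \<star> b\<close>.\<close>
  have au: "a' \<star> u h \<in> D h" using a' h by (simp add: D_mult_left u_in_D)
  define p where "p = \<beta> h (a' \<star> u h)"
  have p: "p \<in> D (inv h)" "p \<in> carrier R" "\<alpha> h p = a' \<star> u h"
    using au h \<beta>_closed \<alpha>_\<beta> D_carrier G unfolding p_def by blast+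
  define d where "d = p \<star> b'"
  have d: "d \<in> D (inv h)" "d \<in> carrier R"
    unfolding d_def using p b' G h by (simp_all add: D_mult_left)
  have \<alpha>d: "\<alpha> h d = a' \<star> b"
    unfolding d_def using p b' a' b bc u h by (simp add: \<alpha>_mult R.m_assoc D_u_left)
  \<comment> \<open>Applying \<open>\<alpha>_comp_w\<close> to \<open>d\<close> also requires
    \<open>d \<in> D (inv h \<otimes> inv g)\<close>. This follows from injectivity of
    \<open>\<alpha> h\<close>, since \<open>a' \<star> b\<close> lies in the image of the smaller
    ideal.\<close>
  have "a' \<star> b \<in> D h \<inter> D (inv g)"
    using a' b bc h G by (simp add: D_mult_left D_mult_right)
  also have "\<dots> = \<alpha> h ` (D (inv h) \<inter> D (inv h \<otimes> inv g))"
    using \<alpha>_image_inter[OF h G(6)] cancel by simp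
  finally obtain s where s: "s \<in> D (inv h)" "s \<in> D (inv h \<otimes> inv g)" "\<alpha> h d = \<alpha> h s"
    unfolding \<alpha>d by blast
  then have dG: "d \<in> D (inv h \<otimes> inv g)" using \<alpha>_inj[OF h d(1) s(1)] by simp
  have dc: "d \<star> c \<in> D (inv h)" "d \<star> c \<in> D (inv h \<otimes> inv g)" "d \<star> c \<in> carrier R"
    using d dG G bc by (simp_all add: D_mult_right)
  have b'c: "b' \<star> c \<in> D (inv h)" using b' bc G by (simp add: D_mult_right)
  define y where "y = a' \<star> \<alpha> h (b' \<star> c)"
  have \<alpha>b'c: "\<alpha> h (b' \<star> c) \<in> D h" "\<alpha> h (b' \<star> c) \<in> carrier R"
    using \<alpha>_closed[OF h b'c] D_carrier h by auto
  have y: "y \<in> D h" "y \<in> D (inv g)" "y \<in> carrier R"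
    unfolding y_def using a' \<alpha>b'c h G by (simp_all add: D_mult_left D_mult_right)
  have \<alpha>dc: "\<alpha> h (d \<star> c) = y"
  proof -
    have "d \<star> c = p \<star> (b' \<star> c)" using p b' bc by (simp add: d_def R.m_assoc)
    then show ?thesis unfolding y_def
      using p b'c a' u \<alpha>b'c h by (simp add: \<alpha>_mult R.m_assoc D_u_left)
  qed
  \<comment> \<open>Writing \<open>w g h\<close> as \<open>\<alpha> (g \<otimes> h) q\<close> moves
    it inside \<open>\<alpha> (g \<otimes> h)\<close>, so that the outer
    \<open>\<beta> (g \<otimes> h)\<close> can be evaluated.\<close>
  define q where "q = \<beta> (g \<otimes> h) (w g h)"
  have q: "q \<in> D (inv h \<otimes> inv g)" "q \<in> carrier R" "\<alpha> (g \<otimes> h) q = w g h"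
    using \<beta>_closed[OF G(1) wgh(2)] \<alpha>_\<beta>[OF G(1) wgh(2)] D_carrier[OF G(6)] unfolding q_def inv by auto
  have "\<alpha> g (a' \<star> b) \<star> w g h = w g h \<star> \<alpha> (g \<otimes> h) d"
    using \<alpha>_comp_w[OF g h d(1) dG] \<alpha>d by simp
  also have "\<dots> = \<alpha> (g \<otimes> h) (q \<star> d)"
    using q dG G inv by (simp add: \<alpha>_mult)
  finally have "\<beta> (g \<otimes> h) (\<alpha> g (a' \<star> b) \<star> w g h) = q \<star> d"
    using q(2) dG G inv by (simp add: \<beta>_\<alpha> D_mult_left)
  then have "monomial_coeff (g \<otimes> h) t (monomial_coeff g h a b) c = \<alpha> (g \<otimes> h) (q \<star> (d \<star> c)) \<star> w (g \<otimes> h) t"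
    unfolding monomial_coeff_def a'_def[symmetric] using q d bc by (simp add: R.m_assoc)
  also have "\<alpha> (g \<otimes> h) (q \<star> (d \<star> c)) = w g h \<star> \<alpha> (g \<otimes> h) (d \<star> c)"
    using q dc G inv by (simp add: \<alpha>_mult)
  also have "\<dots> = \<alpha> g y \<star> w g h"
    using \<alpha>_comp_w[OF g h dc(1,2)] \<alpha>dc by simp
  finally have L: "monomial_coeff (g \<otimes> h) t (monomial_coeff g h a b) c = \<alpha> g y \<star> w g h \<star> w (g \<otimes> h) t" .
  have \<alpha>y: "\<alpha> g y \<in> D g" "\<alpha> g y \<in> carrier R" using \<alpha>_closed[OF g y(2)] D_carrier g by auto
  \<comment> \<open>The cocycle identity applies only inside \<open>D (h \<otimes> t)\<close>, where
    \<open>y\<close> need not lie. Inserting \<open>u (h \<otimes> t)\<close> is harmless: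
    \<open>w h t\<close> absorbs it, and under \<open>\<alpha> g\<close> it turns into
    \<open>u (g \<otimes> (h \<otimes> t))\<close>, which \<open>w (g \<otimes> h) t\<close>
    absorbs.\<close>
  let ?z = "y \<star> u (h \<otimes> t)"
  have z: "?z \<in> D (inv g) \<inter> D h \<inter> D (h \<otimes> t)"
    using y u G h by (simp add: D_mult_right D_mult_left u_in_D)
  have z': "y \<star> w h t = ?z \<star> w h t"
    using y u W wht G by (simp add: R.m_assoc D_u_left)
  have "monomial_coeff g (h \<otimes> t) a (monomial_coeff h t b c) = \<alpha> g (y \<star> w h t) \<star> w g (h \<otimes> t)"
    unfolding monomial_coeff_def a'_def[symmetric] b'_def[symmetric] y_def
    using a' \<alpha>b'c W by (simp add: R.m_assoc)
  also have "\<dots> = \<alpha> g ?z \<star> w g h \<star> w (g \<otimes> h) t"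
    unfolding z' using w_cocycle[OF g h t] z D_prod3[OF G(3) h G(2)] by blast
  also have "\<alpha> g ?z = \<alpha> g (y \<star> (u (inv g) \<star> u (h \<otimes> t)))"
    using y u G by (simp add: D_u_right flip: R.m_assoc)
  also have "\<dots> = \<alpha> g y \<star> (u g \<star> u (g \<otimes> (h \<otimes> t)))"
    using y u g G by (simp add: \<alpha>_mult \<alpha>_u_u D_mult_right u_in_D)
  also have "\<dots> = u (g \<otimes> (h \<otimes> t)) \<star> \<alpha> g y"
    using u \<alpha>y g u_central[OF G(5) \<alpha>y(2)] by (simp add: D_u_right flip: R.m_assoc)
  also have "\<dots> \<star> w g h \<star> w (g \<otimes> h) t = u (g \<otimes> (h \<otimes> t)) \<star> (\<alpha> g y \<star> w g h) \<star> w (g \<otimes> h) t"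
    using u W \<alpha>y by (simp add: R.m_assoc)
  also have "\<dots> = \<alpha> g y \<star> w g h \<star> (u (g \<otimes> h \<otimes> t) \<star> w (g \<otimes> h) t)"
    using u W \<alpha>y u_central[OF G(5), of "\<alpha> g y \<star> w g h"] g h t by (simp add: G.m_assoc R.m_assoc)
  also have "\<dots> = \<alpha> g y \<star> w g h \<star> w (g \<otimes> h) t"
    using wght G t by (simp add: D_u_left)
  finally show ?thesis using L by simp
qed

section \<open>Closure and biadditivity of monomial coefficients\<close>

lemma monomial_coeff_closed:
  assumes "g \<in> carrier G" "h \<in> carrier G" "a \<in> D g" "b \<in> carrier R"
  shows "monomial_coeff g h a b \<in> D (g \<otimes> h)" "monomial_coeff g h a b \<in> carrier R"
proof -
  have "\<alpha> g (\<beta> g a \<star> b) \<in> D g" using assms by (simp add: \<alpha>_closed \<beta>_closed D_mult_right)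
  then show "monomial_coeff g h a b \<in> D (g \<otimes> h)"
    using assms w_props(2)[of g h] D_carrier[of g] by (simp add: monomial_coeff_def D_mult_left)
  then show "monomial_coeff g h a b \<in> carrier R" using D_carrier assms by blast
qed

lemma w_carrier: "g \<in> carrier G \<Longrightarrow> h \<in> carrier G \<Longrightarrow> w g h \<in> carrier R"
  using w_props(1) D_carrier by blast

lemma \<beta>_carrier: "g \<in> carrier G \<Longrightarrow> a \<in> D g \<Longrightarrow> \<beta> g a \<in> carrier R"
  using \<beta>_closed D_carrier G.inv_closed by blast

lemma \<alpha>_carrier: "g \<in> carrier G \<Longrightarrow> a \<in> D (inv g) \<Longrightarrow> \<alpha> g a \<in> carrier R"
  using \<alpha>_closed D_carrier by blast

lemma monomial_coeff_add_left:
  assumes "g \<in> carrier G" "h \<in> carrier G" "a \<in> D g" "a' \<in> D g" "b \<in> carrier R"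
  shows "monomial_coeff g h (a \<oplus>\<^bsub>R\<^esub> a') b = monomial_coeff g h a b \<oplus>\<^bsub>R\<^esub> monomial_coeff g h a' b"
  using assms unfolding monomial_coeff_def
  by (simp add: \<beta>_add \<beta>_closed \<beta>_carrier \<alpha>_carrier R.l_distr \<alpha>_add D_mult_right w_carrier)

lemma monomial_coeff_add_right:
  assumes "g \<in> carrier G" "h \<in> carrier G" "a \<in> D g" "b \<in> carrier R" "b' \<in> carrier R"
  shows "monomial_coeff g h a (b \<oplus>\<^bsub>R\<^esub> b') = monomial_coeff g h a b \<oplus>\<^bsub>R\<^esub> monomial_coeff g h a b'"
  using assms unfolding monomial_coeff_def
  by (simp add: \<beta>_closed \<beta>_carrier \<alpha>_carrier R.l_distr R.r_distr \<alpha>_add D_mult_right w_carrier)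

lemma monomial_coeff_zero_left:
  "g \<in> carrier G \<Longrightarrow> h \<in> carrier G \<Longrightarrow> b \<in> carrier R \<Longrightarrow> monomial_coeff g h \<zero>\<^bsub>R\<^esub> b = \<zero>\<^bsub>R\<^esub>"
  by (simp add: monomial_coeff_def \<beta>_zero \<alpha>_zero w_carrier)

lemma monomial_coeff_zero_right:
  "g \<in> carrier G \<Longrightarrow> h \<in> carrier G \<Longrightarrow> a \<in> D g \<Longrightarrow> monomial_coeff g h a \<zero>\<^bsub>R\<^esub> = \<zero>\<^bsub>R\<^esub>"
  by (simp add: monomial_coeff_def \<beta>_carrier \<alpha>_zero w_carrier)

section \<open>Finite sums in ideals and under additive maps\<close>

lemma ideal_finsum:
  assumes I: "ideal I R" and f: "\<And>i. i \<in> A \<Longrightarrow> f i \<in> I"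
  shows "finsum R f A \<in> I"
  using f
proof (induction A rule: infinite_finite_induct)
  case (insert i A)
  then show ?case using ideal.Icarr[OF I] additive_subgroup.a_closed[OF ideal.axioms(1)[OF I]]
    by (subst R.finsum_insert) auto
qed (simp_all add: additive_subgroup.zero_closed[OF ideal.axioms(1)[OF I]])

lemmas finsum_D = ideal_finsum[OF D_ideal]

text \<open>Additivity of \<open>\<phi>\<close> is asked only on \<open>D g\<close>: the first
  argument of \<open>monomial_coeff g h\<close> passes through \<open>\<beta> g\<close>, which is
  meaningful only there.\<close>

lemma additive_finsum:
  assumes g: "g \<in> carrier G" and f: "\<And>i. i \<in> A \<Longrightarrow> f i \<in> D g" and A: "finite A"
    and \<phi>: "\<And>a. a \<in> D g \<Longrightarrow> \<phi> a \<in> carrier R" "\<phi> \<zero>\<^bsub>R\<^esub> = \<zero>\<^bsub>R\<^esub>"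
      "\<And>a b. a \<in> D g \<Longrightarrow> b \<in> D g \<Longrightarrow> \<phi> (a \<oplus>\<^bsub>R\<^esub> b) = \<phi> a \<oplus>\<^bsub>R\<^esub> \<phi> b"
  shows "\<phi> (finsum R f A) = finsum R (\<lambda>i. \<phi> (f i)) A"
  using A f
proof (induction A)
  case (insert i A)
  have "\<phi> (finsum R f (insert i A)) = \<phi> (f i \<oplus>\<^bsub>R\<^esub> finsum R f A)"
    using insert g D_carrier by (subst R.finsum_insert) auto
  also have "\<dots> = \<phi> (f i) \<oplus>\<^bsub>R\<^esub> finsum R (\<lambda>i. \<phi> (f i)) A"
    using insert g finsum_D[of g A f] by (simp add: \<phi>)
  also have "\<dots> = finsum R (\<lambda>i. \<phi> (f i)) (insert i A)"
    using insert by (subst R.finsum_insert) (auto simp: \<phi>)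
  finally show ?case .
qed (simp add: \<phi>)

lemma finsum_swap:
  assumes A: "finite A" and B: "finite B"
    and f: "\<And>i j. i \<in> A \<Longrightarrow> j \<in> B \<Longrightarrow> f i j \<in> carrier R"
  shows "finsum R (\<lambda>i. finsum R (f i) B) A = finsum R (\<lambda>j. finsum R (\<lambda>i. f i j) A) B"
  using A f
proof (induction A)
  case (insert i A)
  have "finsum R (\<lambda>i. finsum R (f i) B) (insert i A) = finsum R (f i) B \<oplus>\<^bsub>R\<^esub> finsum R (\<lambda>i. finsum R (f i) B) A"
    using insert by (subst R.finsum_insert) (auto intro: R.finsum_closed)
  also have "\<dots> = finsum R (f i) B \<oplus>\<^bsub>R\<^esub> finsum R (\<lambda>j. finsum R (\<lambda>i. f i j) A) B"
    using insert by simp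
  also have "\<dots> = finsum R (\<lambda>j. f i j \<oplus>\<^bsub>R\<^esub> finsum R (\<lambda>i. f i j) A) B"
    using insert by (intro R.finsum_addf[symmetric]) (auto intro: R.finsum_closed)
  also have "\<dots> = finsum R (\<lambda>j. finsum R (\<lambda>i. f i j) (insert i A)) B"
    using insert by (intro R.finsum_cong') (auto intro!: R.finsum_closed R.finsum_insert[symmetric])
  finally show ?case .
qed simp

subsection \<open>The crossed product is a ring\<close>

abbreviation S where "S \<equiv> partial_crossed_product G R D \<alpha> w"

section \<open>Coefficients, supports and the convolution formula\<close>

lemma S_carrier:
  "x \<in> carrier S \<longleftrightarrow> x \<in> extensional (carrier G) \<and> (\<forall>g\<in>carrier G. x g \<in> D g) \<and> finite (supp G R x)"
  by (auto simp: partial_crossed_product_def PiE_def)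

lemma S_coeff: "x \<in> carrier S \<Longrightarrow> g \<in> carrier G \<Longrightarrow> x g \<in> D g"
  by (simp add: S_carrier)

lemma S_coeff_carrier: "x \<in> carrier S \<Longrightarrow> g \<in> carrier G \<Longrightarrow> x g \<in> carrier R"
  using S_coeff D_carrier by blast

lemma S_supp: "x \<in> carrier S \<Longrightarrow> finite (supp G R x)"
  by (simp add: S_carrier)

lemma S_eqI:
  "\<lbrakk>x \<in> extensional (carrier G); y \<in> extensional (carrier G); \<And>k. k \<in> carrier G \<Longrightarrow> x k = y k\<rbrakk> \<Longrightarrow> x = y"
  by (rule extensionalityI)

lemma S_add: "k \<in> carrier G \<Longrightarrow> (x \<oplus>\<^bsub>S\<^esub> y) k = x k \<oplus>\<^bsub>R\<^esub> y k"
  by (simp add: partial_crossed_product_def)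

lemma S_zero: "k \<in> carrier G \<Longrightarrow> \<zero>\<^bsub>S\<^esub> k = \<zero>\<^bsub>R\<^esub>"
  by (simp add: partial_crossed_product_def delta_one_def)

lemma S_extensional:
  "x \<oplus>\<^bsub>S\<^esub> y \<in> extensional (carrier G)" "x \<otimes>\<^bsub>S\<^esub> y \<in> extensional (carrier G)"
  "\<zero>\<^bsub>S\<^esub> \<in> extensional (carrier G)" "\<one>\<^bsub>S\<^esub> \<in> extensional (carrier G)"
  "delta_one G R r \<in> extensional (carrier G)"
  by (simp_all add: partial_crossed_product_def delta_one_def)

lemma S_carrier_extensional: "x \<in> carrier S \<Longrightarrow> x \<in> extensional (carrier G)"
  by (simp add: S_carrier)

lemma finsum_restrict:
  assumes "finite A" "B \<subseteq> A" "\<And>i. i \<in> A - B \<Longrightarrow> f i = \<zero>\<^bsub>R\<^esub>" "\<And>i. i \<in> B \<Longrightarrow> f i \<in> carrier R"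
  shows "finsum R f A = finsum R f B"
proof (rule R.add.finprod_mono_neutral_cong_right)
  show "f \<in> A \<rightarrow> carrier R" using assms(3,4) by (metis Diff_iff Pi_I R.zero_closed)
qed (use assms in auto)

lemma inv_mult_cancel:
  assumes "g \<in> carrier G" "k \<in> carrier G"
  shows "g \<otimes> (inv g \<otimes> k) = k" "inv g \<otimes> (g \<otimes> k) = k" "k \<otimes> inv g \<otimes> g = k"
  using assms by (simp_all add: G.m_assoc flip: G.m_assoc[of g "inv g" k] G.m_assoc[of "inv g" g k])

text \<open>A pair \<open>(g, h)\<close> with product \<open>k\<close> is determined by
  \<open>g\<close>, so the sum over pairs becomes a sum over \<open>g\<close>. Terms outside the
  supports vanish, so any finite \<open>A\<close> containing the left support serves; this allows
  several products to be summed over a common index set.\<close>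

lemma S_mult:
  assumes x: "x \<in> carrier S" and y: "y \<in> carrier S" and k: "k \<in> carrier G"
    and A: "finite A" "supp G R x \<subseteq> A" "A \<subseteq> carrier G"
  shows "(x \<otimes>\<^bsub>S\<^esub> y) k = finsum R (\<lambda>g. monomial_coeff g (inv g \<otimes> k) (x g) (y (inv g \<otimes> k))) A"
proof -
  let ?f = "\<lambda>g. monomial_coeff g (inv g \<otimes> k) (x g) (y (inv g \<otimes> k))"
  let ?B = "{g \<in> supp G R x. inv g \<otimes> k \<in> supp G R y}"
  let ?F = "\<lambda>(g, h). monomial_coeff g h (x g) (y h)"
  let ?P = "{(g, h) \<in> supp G R x \<times> supp G R y. g \<otimes> h = k}"
  have P: "?P = (\<lambda>g. (g, inv g \<otimes> k)) ` ?B"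
    using k inv_mult_cancel by (force simp: supp_def image_iff)
  have f: "?f g \<in> carrier R" if "g \<in> carrier G" for g
    using that x y k by (simp add: monomial_coeff_closed S_coeff S_coeff_carrier)
  have "(x \<otimes>\<^bsub>S\<^esub> y) k = finsum R ?F ?P"
    using k by (simp add: partial_crossed_product_def monomial_coeff_def \<beta>_def)
  also have "\<dots> = finsum R (\<lambda>g. ?F (g, inv g \<otimes> k)) ?B"
    unfolding P by (rule R.finsum_reindex) (auto simp: inj_on_def supp_def f)
  also have "\<dots> = finsum R ?f ?B" by simp
  also have "\<dots> = finsum R ?f A"
  proof (rule finsum_restrict[symmetric, OF A(1)])
    fix g assume g: "g \<in> A - ?B"
    then have "x g = \<zero>\<^bsub>R\<^esub> \<or> y (inv g \<otimes> k) = \<zero>\<^bsub>R\<^esub>" using A k by (auto simp: supp_def)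
    then show "?f g = \<zero>\<^bsub>R\<^esub>"
      using g A k x y by (auto simp: monomial_coeff_zero_left monomial_coeff_zero_right S_coeff S_coeff_carrier subset_iff)
  qed (use A f in \<open>auto simp: supp_def\<close>)
  finally show ?thesis .
qed

section \<open>Monomials, and closure and associativity of the multiplication\<close>

definition monomial :: "'g \<Rightarrow> 'a \<Rightarrow> 'g \<Rightarrow> 'a"
  where "monomial h c = (\<lambda>g\<in>carrier G. if g = h then c else \<zero>\<^bsub>R\<^esub>)"

lemma delta_one_monomial: "delta_one G R r = monomial \<one> r"
  by (simp add: delta_one_def monomial_def)

lemma monomial_closed: "h \<in> carrier G \<Longrightarrow> c \<in> D h \<Longrightarrow> monomial h c \<in> carrier S"
  by (auto simp: S_carrier monomial_def D_zero supp_def)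

lemma delta_one_closed: "r \<in> carrier R \<Longrightarrow> delta_one G R r \<in> carrier S"
  by (simp add: delta_one_monomial monomial_closed D_one)

lemma S_mult_closed:
  assumes x: "x \<in> carrier S" and y: "y \<in> carrier S"
  shows "x \<otimes>\<^bsub>S\<^esub> y \<in> carrier S"
proof -
  have sx: "supp G R x \<subseteq> carrier G" by (auto simp: supp_def)
  note mult = S_mult[OF x y _ S_supp[OF x] subset_refl sx]
  have "(x \<otimes>\<^bsub>S\<^esub> y) k \<in> D k" if k: "k \<in> carrier G" for k
    unfolding mult[OF k]
  proof (rule finsum_D[OF k])
    fix g assume "g \<in> supp G R x"
    then have g: "g \<in> carrier G" by (simp add: supp_def)
    then show "monomial_coeff g (inv g \<otimes> k) (x g) (y (inv g \<otimes> k)) \<in> D k"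
      using monomial_coeff_closed(1)[of g "inv g \<otimes> k" "x g" "y (inv g \<otimes> k)"] k x y
      by (simp add: S_coeff S_coeff_carrier inv_mult_cancel)
  qed
  \<comment> \<open>If \<open>k\<close> is not a product of elements of the two supports, every term
    of the convolution at \<open>k\<close> has right factor zero.\<close>
  moreover have "supp G R (x \<otimes>\<^bsub>S\<^esub> y) \<subseteq> (\<lambda>(g, h). g \<otimes> h) ` (supp G R x \<times> supp G R y)"
  proof (rule subsetI, rule ccontr)
    fix k assume "k \<in> supp G R (x \<otimes>\<^bsub>S\<^esub> y)" and nk: "k \<notin> (\<lambda>(g, h). g \<otimes> h) ` (supp G R x \<times> supp G R y)"
    then have k: "k \<in> carrier G" and ne: "(x \<otimes>\<^bsub>S\<^esub> y) k \<noteq> \<zero>\<^bsub>R\<^esub>" by (auto simp: supp_def)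
    have "y (inv g \<otimes> k) = \<zero>\<^bsub>R\<^esub>" if "g \<in> supp G R x" for g
    proof (rule ccontr)
      assume "y (inv g \<otimes> k) \<noteq> \<zero>\<^bsub>R\<^esub>"
      then have "(g, inv g \<otimes> k) \<in> supp G R x \<times> supp G R y" using that k by (simp add: supp_def)
      moreover have "g \<otimes> (inv g \<otimes> k) = k" using that k inv_mult_cancel by (simp add: supp_def)
      ultimately show False using nk by force
    qed
    then have "(x \<otimes>\<^bsub>S\<^esub> y) k = \<zero>\<^bsub>R\<^esub>"
      unfolding mult[OF k] using k x
      by (intro R.add.finprod_one_eqI) (auto simp: supp_def monomial_coeff_zero_right S_coeff)
    then show False using ne by simp
  qed
  then have "finite (supp G R (x \<otimes>\<^bsub>S\<^esub> y))"
    using S_supp[OF x] S_supp[OF y] by (meson finite_SigmaI finite_imageI finite_subset)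
  ultimately show ?thesis by (simp add: S_carrier S_extensional)
qed

text \<open>The coefficient at \<open>k\<close> is a double sum over \<open>g\<close> in the support
  of \<open>x\<close> and a partial product \<open>f = g h\<close>. Applying
  \<open>monomial_coeff_assoc\<close> termwise with indices \<open>g\<close>, \<open>g^-1 f\<close>,
  \<open>f^-1 k\<close> and exchanging the sums turns one bracketing into the other.\<close>

lemma S_mult_assoc:
  assumes x: "x \<in> carrier S" and y: "y \<in> carrier S" and z: "z \<in> carrier S"
  shows "x \<otimes>\<^bsub>S\<^esub> y \<otimes>\<^bsub>S\<^esub> z = x \<otimes>\<^bsub>S\<^esub> (y \<otimes>\<^bsub>S\<^esub> z)"
proof (rule S_eqI[OF S_extensional(2) S_extensional(2)])
  fix k assume k: "k \<in> carrier G"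
  let ?A = "supp G R x"
  let ?M = monomial_coeff
  note xy = S_mult_closed[OF x y] and yz = S_mult_closed[OF y z]
  have A: "finite ?A" "?A \<subseteq> carrier G" using S_supp[OF x] by (auto simp: supp_def)
  \<comment> \<open>\<open>F\<close> contains the support of \<open>x y\<close> for the left-hand
    sum, and all products \<open>g h\<close> so that its translates by \<open>g^-1\<close> cover the
    support of \<open>y\<close> in the right-hand sum.\<close>
  obtain F where F: "finite F" "F \<subseteq> carrier G"
    and Fxy: "supp G R (x \<otimes>\<^bsub>S\<^esub> y) \<subseteq> F" "\<And>g h. g \<in> ?A \<Longrightarrow> h \<in> supp G R y \<Longrightarrow> g \<otimes> h \<in> F"
  proof
    let ?F = "supp G R (x \<otimes>\<^bsub>S\<^esub> y) \<union> (\<lambda>(g, h). g \<otimes> h) ` (?A \<times> supp G R y)"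
    show "finite ?F" "?F \<subseteq> carrier G"
      using S_supp[OF x] S_supp[OF y] S_supp[OF xy] by (auto simp: supp_def)
  qed auto
  have D: "x g \<in> D g" "y g \<in> D g" "z g \<in> D g" "x g \<in> carrier R" "y g \<in> carrier R" "z g \<in> carrier R"
    if "g \<in> carrier G" for g using that x y z S_coeff S_coeff_carrier by auto
  \<comment> \<open>The contribution of \<open>f\<close> to the coefficient of \<open>y z\<close> at
    \<open>inv g \<otimes> k\<close>.\<close>
  let ?T = "\<lambda>g f. ?M (inv g \<otimes> f) (inv f \<otimes> k) (y (inv g \<otimes> f)) (z (inv f \<otimes> k))"
  have T: "?T g f \<in> D (inv g \<otimes> k)" "?T g f \<in> carrier R" if "g \<in> carrier G" "f \<in> carrier G" for g f
  proof -
    have "inv g \<otimes> f \<otimes> (inv f \<otimes> k) = inv g \<otimes> k"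
      using that k by (simp add: G.m_assoc inv_mult_cancel)
    then show "?T g f \<in> D (inv g \<otimes> k)" "?T g f \<in> carrier R"
      using monomial_coeff_closed[of "inv g \<otimes> f" "inv f \<otimes> k" "y (inv g \<otimes> f)" "z (inv f \<otimes> k)"] that k D
      by auto
  qed
  have Mc: "?M g (inv g \<otimes> k) (x g) (?T g f) \<in> carrier R" if "g \<in> ?A" "f \<in> F" for g f
  proof -
    have "g \<in> carrier G" "f \<in> carrier G" using that A F by auto
    then show ?thesis using k T D by (intro monomial_coeff_closed) auto
  qed
  have L: "?M f (inv f \<otimes> k) ((x \<otimes>\<^bsub>S\<^esub> y) f) (z (inv f \<otimes> k)) =
      finsum R (\<lambda>g. ?M g (inv g \<otimes> k) (x g) (?T g f)) ?A" if f: "f \<in> carrier G" for f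
  proof -
    let ?p = "\<lambda>g. ?M g (inv g \<otimes> f) (x g) (y (inv g \<otimes> f))"
    have p: "?p g \<in> D f" if "g \<in> ?A" for g
      using monomial_coeff_closed(1)[of g "inv g \<otimes> f" "x g" "y (inv g \<otimes> f)"] that f A D
      by (simp add: inv_mult_cancel subset_iff)
    have "?M f (inv f \<otimes> k) ((x \<otimes>\<^bsub>S\<^esub> y) f) (z (inv f \<otimes> k)) =
        ?M f (inv f \<otimes> k) (finsum R ?p ?A) (z (inv f \<otimes> k))"
      using S_mult[OF x y f A(1) subset_refl A(2)] by simp
    also have "\<dots> = finsum R (\<lambda>g. ?M f (inv f \<otimes> k) (?p g) (z (inv f \<otimes> k))) ?A"
      using f k p A D
      by (intro additive_finsum[of f ?A ?p "\<lambda>a. ?M f (inv f \<otimes> k) a (z (inv f \<otimes> k))"])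
        (simp_all add: monomial_coeff_closed monomial_coeff_zero_left monomial_coeff_add_left)
    also have "\<dots> = finsum R (\<lambda>g. ?M g (inv g \<otimes> k) (x g) (?T g f)) ?A"
    proof (rule R.finsum_cong'[OF refl])
      fix g assume "g \<in> ?A"
      then have g: "g \<in> carrier G" using A by auto
      have "g \<otimes> (inv g \<otimes> f) = f" "inv g \<otimes> f \<otimes> (inv f \<otimes> k) = inv g \<otimes> k"
        using f g k by (simp_all add: G.m_assoc inv_mult_cancel)
      then show "?M f (inv f \<otimes> k) (?p g) (z (inv f \<otimes> k)) = ?M g (inv g \<otimes> k) (x g) (?T g f)"
        using monomial_coeff_assoc[of g "inv g \<otimes> f" "inv f \<otimes> k" "x g" "y (inv g \<otimes> f)" "z (inv f \<otimes> k)"]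
          f g k D by simp
    qed (use A k f T D in \<open>auto intro!: monomial_coeff_closed\<close>)
    finally show ?thesis .
  qed
  have "(x \<otimes>\<^bsub>S\<^esub> y \<otimes>\<^bsub>S\<^esub> z) k = finsum R (\<lambda>f. ?M f (inv f \<otimes> k) ((x \<otimes>\<^bsub>S\<^esub> y) f) (z (inv f \<otimes> k))) F"
    by (rule S_mult[OF xy z k F(1) Fxy(1) F(2)])
  also have "\<dots> = finsum R (\<lambda>f. finsum R (\<lambda>g. ?M g (inv g \<otimes> k) (x g) (?T g f)) ?A) F"
  proof (rule R.finsum_cong'[OF refl])
    show "(\<lambda>f. finsum R (\<lambda>g. ?M g (inv g \<otimes> k) (x g) (?T g f)) ?A) \<in> F \<rightarrow> carrier R"
      by (intro Pi_I R.finsum_closed Mc)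
  qed (use F(2) L in blast)
  also have "\<dots> = finsum R (\<lambda>g. finsum R (\<lambda>f. ?M g (inv g \<otimes> k) (x g) (?T g f)) F) ?A"
    by (intro finsum_swap F A Mc)
  also have "\<dots> = finsum R (\<lambda>g. ?M g (inv g \<otimes> k) (x g) ((y \<otimes>\<^bsub>S\<^esub> z) (inv g \<otimes> k))) ?A"
  proof (rule R.finsum_cong'[OF refl])
    fix g assume gA: "g \<in> ?A"
    then have g: "g \<in> carrier G" using A by auto
    let ?B = "(\<lambda>f. inv g \<otimes> f) ` F"
    have sub: "supp G R y \<subseteq> ?B"
    proof
      fix h assume h: "h \<in> supp G R y"
      then have "g \<otimes> h \<in> F" using gA Fxy by blast
      moreover have "h = inv g \<otimes> (g \<otimes> h)" using g h by (simp add: inv_mult_cancel supp_def)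
      ultimately show "h \<in> ?B" by blast
    qed
    have inj: "inj_on (\<lambda>f. inv g \<otimes> f) F" using F(2) g by (auto intro!: inj_onI simp: subset_iff)
    have "(y \<otimes>\<^bsub>S\<^esub> z) (inv g \<otimes> k) =
        finsum R (\<lambda>h. ?M h (inv h \<otimes> (inv g \<otimes> k)) (y h) (z (inv h \<otimes> (inv g \<otimes> k)))) ?B"
      using g k F sub by (intro S_mult[OF y z]) auto
    also have "\<dots> = finsum R (\<lambda>f. ?M (inv g \<otimes> f) (inv (inv g \<otimes> f) \<otimes> (inv g \<otimes> k)) (y (inv g \<otimes> f))
        (z (inv (inv g \<otimes> f) \<otimes> (inv g \<otimes> k)))) F"
      using g k F(2) D by (intro R.finsum_reindex inj) (auto intro!: monomial_coeff_closed)
    also have "\<dots> = finsum R (?T g) F"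
    proof (rule R.finsum_cong'[OF refl])
      fix f assume "f \<in> F"
      then have "f \<in> carrier G" using F by blast
      then have "inv (inv g \<otimes> f) \<otimes> (inv g \<otimes> k) = inv f \<otimes> k"
        using g k by (simp add: G.inv_mult_group G.m_assoc inv_mult_cancel)
      then show "?M (inv g \<otimes> f) (inv (inv g \<otimes> f) \<otimes> (inv g \<otimes> k)) (y (inv g \<otimes> f))
        (z (inv (inv g \<otimes> f) \<otimes> (inv g \<otimes> k))) = ?T g f" by simp
    qed (use T g F in blast)
    finally have "?M g (inv g \<otimes> k) (x g) ((y \<otimes>\<^bsub>S\<^esub> z) (inv g \<otimes> k)) =
        ?M g (inv g \<otimes> k) (x g) (finsum R (?T g) F)" by simp
    also have "\<dots> = finsum R (\<lambda>f. ?M g (inv g \<otimes> k) (x g) (?T g f)) F"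
      using g k F D T D_carrier[of "inv g \<otimes> k"]
      by (intro additive_finsum[of "inv g \<otimes> k" F "?T g"])
        (auto simp: monomial_coeff_closed monomial_coeff_zero_right monomial_coeff_add_right subset_iff)
    finally show "finsum R (\<lambda>f. ?M g (inv g \<otimes> k) (x g) (?T g f)) F =
        ?M g (inv g \<otimes> k) (x g) ((y \<otimes>\<^bsub>S\<^esub> z) (inv g \<otimes> k))" by simp
  qed (use A k yz D S_coeff_carrier in \<open>auto intro!: monomial_coeff_closed\<close>)
  also have "\<dots> = (x \<otimes>\<^bsub>S\<^esub> (y \<otimes>\<^bsub>S\<^esub> z)) k"
    by (rule S_mult[OF x yz k A(1) subset_refl A(2), symmetric])
  finally show "(x \<otimes>\<^bsub>S\<^esub> y \<otimes>\<^bsub>S\<^esub> z) k = (x \<otimes>\<^bsub>S\<^esub> (y \<otimes>\<^bsub>S\<^esub> z)) k" .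
qed

lemma S_mult_monomial_left:
  assumes x: "x \<in> carrier S" and h: "h \<in> carrier G" and c: "c \<in> D h" and k: "k \<in> carrier G"
  shows "(monomial h c \<otimes>\<^bsub>S\<^esub> x) k = monomial_coeff h (inv h \<otimes> k) c (x (inv h \<otimes> k))"
proof -
  have "(monomial h c \<otimes>\<^bsub>S\<^esub> x) k =
      finsum R (\<lambda>g. monomial_coeff g (inv g \<otimes> k) (monomial h c g) (x (inv g \<otimes> k))) {h}"
    using h by (intro S_mult monomial_closed x c k) (auto simp: supp_def monomial_def)
  also have "\<dots> = monomial_coeff h (inv h \<otimes> k) c (x (inv h \<otimes> k))"
    using h c k x by (subst R.finsum_insert) (simp_all add: monomial_def monomial_coeff_closed S_coeff_carrier)
  finally show ?thesis .
qed

lemma S_mult_monomial_right: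
  assumes x: "x \<in> carrier S" and h: "h \<in> carrier G" and c: "c \<in> D h" and k: "k \<in> carrier G"
  shows "(x \<otimes>\<^bsub>S\<^esub> monomial h c) k = monomial_coeff (k \<otimes> inv h) h (x (k \<otimes> inv h)) c"
proof -
  \<comment> \<open>The only term that can be nonzero sits at \<open>k \<otimes> inv h\<close>;
    inserting this index makes the reduction to one term valid even when \<open>x\<close> vanishes
    there.\<close>
  let ?A = "insert (k \<otimes> inv h) (supp G R x)"
  let ?f = "\<lambda>g. monomial_coeff g (inv g \<otimes> k) (x g) (monomial h c (inv g \<otimes> k))"
  have A: "finite ?A" "?A \<subseteq> carrier G" using S_supp[OF x] h k by (auto simp: supp_def)
  have kh: "k \<otimes> inv h \<in> carrier G" "inv (k \<otimes> inv h) \<otimes> k = h"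
    using h k by (simp_all add: G.inv_mult_group G.m_assoc)
  have "(x \<otimes>\<^bsub>S\<^esub> monomial h c) k = finsum R ?f ?A"
    using A by (intro S_mult x monomial_closed h c k) auto
  also have "\<dots> = finsum R ?f {k \<otimes> inv h}"
  proof (rule finsum_restrict[OF A(1)])
    fix g assume "g \<in> ?A - {k \<otimes> inv h}"
    then have g: "g \<in> carrier G" "g \<noteq> k \<otimes> inv h" using A by auto
    then have "inv g \<otimes> k \<noteq> h" using h k by (metis G.inv_closed G.m_closed G.inv_solve_left G.inv_solve_right)
    then show "?f g = \<zero>\<^bsub>R\<^esub>" using g k x by (simp add: monomial_def monomial_coeff_zero_right S_coeff)
  next
    fix g assume "g \<in> {k \<otimes> inv h}"
    then show "?f g \<in> carrier R"
      using kh h c x k D_carrier by (auto intro!: monomial_coeff_closed S_coeff simp: monomial_def)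
  qed simp
  also have "\<dots> = monomial_coeff (k \<otimes> inv h) h (x (k \<otimes> inv h)) c"
    using kh h c x D_carrier[OF h c] by (subst R.finsum_insert) (simp_all add: monomial_def monomial_coeff_closed S_coeff)
  finally show ?thesis .
qed

lemma S_mult_delta_left:
  assumes x: "x \<in> carrier S" and r: "r \<in> carrier R" and k: "k \<in> carrier G"
  shows "(delta_one G R r \<otimes>\<^bsub>S\<^esub> x) k = r \<star> x k"
proof -
  have "\<beta> \<one> r = r" using \<beta>_\<alpha>[of \<one> r] \<alpha>_one r by (simp add: D_one)
  then show ?thesis
    using S_mult_monomial_left[OF x G.one_closed _ k, of r] r k x S_coeff[OF x k]
    by (simp add: delta_one_monomial D_one monomial_coeff_def \<alpha>_one w_one_left R.m_assoc S_coeff_carrier u_closed D_u_right)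
qed

text \<open>Unlike on the left, \<open>r\<close> is here transported through
  \<open>\<alpha> k\<close>; the twist \<open>w k \<one>\<close> is \<open>u k\<close>, which acts
  trivially on \<open>D k\<close>.\<close>

lemma S_mult_delta_right:
  assumes x: "x \<in> carrier S" and r: "r \<in> carrier R" and k: "k \<in> carrier G"
  shows "(x \<otimes>\<^bsub>S\<^esub> delta_one G R r) k = \<alpha> k (\<beta> k (x k) \<star> r)"
proof -
  have "\<alpha> k (\<beta> k (x k) \<star> r) \<in> D k"
    using x k r by (simp add: \<alpha>_closed \<beta>_closed D_mult_right S_coeff)
  then show ?thesis
    using S_mult_monomial_right[OF x G.one_closed _ k, of r] r k
    by (simp add: delta_one_monomial D_one monomial_coeff_def w_one_right D_u_right)
qed

lemma S_mult_delta_right_one: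
  assumes x: "x \<in> carrier S" and r: "r \<in> carrier R"
  shows "(x \<otimes>\<^bsub>S\<^esub> delta_one G R r) \<one> = x \<one> \<star> r"
proof -
  have "\<beta> \<one> (x \<one>) = x \<one>" using \<beta>_\<alpha>[of \<one> "x \<one>"] \<alpha>_one x by (simp add: D_one S_coeff_carrier)
  then show ?thesis using S_mult_delta_right[OF x r G.one_closed] x r by (simp add: \<alpha>_one S_coeff_carrier)
qed

lemma S_one: "\<one>\<^bsub>S\<^esub> = delta_one G R \<one>\<^bsub>R\<^esub>" and S_zero_delta: "\<zero>\<^bsub>S\<^esub> = delta_one G R \<zero>\<^bsub>R\<^esub>"
  by (simp_all add: partial_crossed_product_def)

section \<open>The ring axioms\<close>

lemma S_add_closed:
  assumes x: "x \<in> carrier S" and y: "y \<in> carrier S"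
  shows "x \<oplus>\<^bsub>S\<^esub> y \<in> carrier S"
proof -
  have "supp G R (x \<oplus>\<^bsub>S\<^esub> y) \<subseteq> supp G R x \<union> supp G R y" by (auto simp: supp_def S_add)
  then have "finite (supp G R (x \<oplus>\<^bsub>S\<^esub> y))"
    using S_supp[OF x] S_supp[OF y] finite_subset by blast
  then show ?thesis using x y by (simp add: S_carrier S_extensional S_add D_add)
qed

lemma S_uminus:
  assumes x: "x \<in> carrier S"
  shows "\<exists>y\<in>carrier S. y \<oplus>\<^bsub>S\<^esub> x = \<zero>\<^bsub>S\<^esub>"
proof
  let ?y = "\<lambda>g\<in>carrier G. \<ominus>\<^bsub>R\<^esub> x g"
  have "supp G R ?y \<subseteq> supp G R x" using S_coeff_carrier[OF x] by (auto simp: supp_def)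
  then have "finite (supp G R ?y)" using S_supp[OF x] finite_subset by blast
  then show "?y \<in> carrier S" using x by (simp add: S_carrier D_minus)
  show "?y \<oplus>\<^bsub>S\<^esub> x = \<zero>\<^bsub>S\<^esub>"
    by (rule S_eqI[OF S_extensional(1,3)]) (simp add: S_add S_zero R.l_neg S_coeff_carrier[OF x])
qed

lemma S_ring: "ring S"
proof (rule ringI)
  show "abelian_group S"
  proof (rule abelian_groupI)
    show "\<zero>\<^bsub>S\<^esub> \<in> carrier S" by (simp add: S_zero_delta delta_one_closed)
  next
    fix x y z assume "x \<in> carrier S" "y \<in> carrier S" "z \<in> carrier S"
    then show "x \<oplus>\<^bsub>S\<^esub> y \<oplus>\<^bsub>S\<^esub> z = x \<oplus>\<^bsub>S\<^esub> (y \<oplus>\<^bsub>S\<^esub> z)"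
      by (intro S_eqI[OF S_extensional(1,1)]) (simp add: S_add R.a_assoc S_coeff_carrier)
  next
    fix x y assume "x \<in> carrier S" "y \<in> carrier S"
    then show "x \<oplus>\<^bsub>S\<^esub> y = y \<oplus>\<^bsub>S\<^esub> x"
      by (intro S_eqI[OF S_extensional(1,1)]) (simp add: S_add R.a_comm S_coeff_carrier)
  next
    fix x assume "x \<in> carrier S"
    then show "\<zero>\<^bsub>S\<^esub> \<oplus>\<^bsub>S\<^esub> x = x"
      by (intro S_eqI[OF S_extensional(1) S_carrier_extensional]) (simp_all add: S_add S_zero S_coeff_carrier)
  qed (fact S_add_closed S_uminus)+
  show "Group.monoid S"
  proof (rule monoidI)
    show "\<one>\<^bsub>S\<^esub> \<in> carrier S" by (simp add: S_one delta_one_closed)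
  next
    fix x assume x: "x \<in> carrier S"
    show "\<one>\<^bsub>S\<^esub> \<otimes>\<^bsub>S\<^esub> x = x"
      using x by (intro S_eqI[OF S_extensional(2) S_carrier_extensional])
        (simp_all add: S_one S_mult_delta_left S_coeff_carrier)
    show "x \<otimes>\<^bsub>S\<^esub> \<one>\<^bsub>S\<^esub> = x"
      using x by (intro S_eqI[OF S_extensional(2) S_carrier_extensional])
        (simp_all add: S_one S_mult_delta_right S_coeff \<beta>_carrier \<alpha>_\<beta>)
  qed (fact S_mult_closed S_mult_assoc)+
next
  fix x y z assume x: "x \<in> carrier S" and y: "y \<in> carrier S" and z: "z \<in> carrier S"
  have sub: "supp G R v \<subseteq> carrier G" for v by (auto simp: supp_def)
  show "(x \<oplus>\<^bsub>S\<^esub> y) \<otimes>\<^bsub>S\<^esub> z = x \<otimes>\<^bsub>S\<^esub> z \<oplus>\<^bsub>S\<^esub> y \<otimes>\<^bsub>S\<^esub> z"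
  proof (rule S_eqI[OF S_extensional(2,1)])
    fix k assume k: "k \<in> carrier G"
    \<comment> \<open>The union of the supports serves as index set for all three products, although
      cancellation may make the support of the sum smaller.\<close>
    let ?A = "supp G R x \<union> supp G R y"
    have A: "finite ?A" "?A \<subseteq> carrier G" using S_supp x y sub by auto
    let ?f = "\<lambda>x g. monomial_coeff g (inv g \<otimes> k) (x g) (z (inv g \<otimes> k))"
    have f: "?f v g \<in> carrier R" if "v \<in> carrier S" "g \<in> ?A" for v g
      using that A k z by (intro monomial_coeff_closed S_coeff S_coeff_carrier) auto
    have "((x \<oplus>\<^bsub>S\<^esub> y) \<otimes>\<^bsub>S\<^esub> z) k = finsum R (?f (x \<oplus>\<^bsub>S\<^esub> y)) ?A"
      by (intro S_mult S_add_closed x y z k A) (auto simp: supp_def S_add)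
    also have "\<dots> = finsum R (\<lambda>g. ?f x g \<oplus>\<^bsub>R\<^esub> ?f y g) ?A"
    proof (rule R.finsum_cong'[OF refl])
      fix g assume "g \<in> ?A"
      then have "g \<in> carrier G" using A by auto
      then show "?f (x \<oplus>\<^bsub>S\<^esub> y) g = ?f x g \<oplus>\<^bsub>R\<^esub> ?f y g"
        using x y z k by (simp add: S_add monomial_coeff_add_left S_coeff S_coeff_carrier)
    qed (intro Pi_I R.a_closed f x y)
    also have "\<dots> = finsum R (?f x) ?A \<oplus>\<^bsub>R\<^esub> finsum R (?f y) ?A"
      by (intro R.finsum_addf Pi_I f x y)
    also have "\<dots> = (x \<otimes>\<^bsub>S\<^esub> z) k \<oplus>\<^bsub>R\<^esub> (y \<otimes>\<^bsub>S\<^esub> z) k"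
      using S_mult[OF x z k A(1) _ A(2)] S_mult[OF y z k A(1) _ A(2)] by simp
    finally show "((x \<oplus>\<^bsub>S\<^esub> y) \<otimes>\<^bsub>S\<^esub> z) k = (x \<otimes>\<^bsub>S\<^esub> z \<oplus>\<^bsub>S\<^esub> y \<otimes>\<^bsub>S\<^esub> z) k"
      using k by (simp add: S_add)
  qed
  show "z \<otimes>\<^bsub>S\<^esub> (x \<oplus>\<^bsub>S\<^esub> y) = z \<otimes>\<^bsub>S\<^esub> x \<oplus>\<^bsub>S\<^esub> z \<otimes>\<^bsub>S\<^esub> y"
  proof (rule S_eqI[OF S_extensional(2,1)])
    fix k assume k: "k \<in> carrier G"
    let ?A = "supp G R z"
    let ?f = "\<lambda>x g. monomial_coeff g (inv g \<otimes> k) (z g) (x (inv g \<otimes> k))"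
    have f: "?f v g \<in> carrier R" if "v \<in> carrier S" "g \<in> ?A" for v g
      using that sub k z by (intro monomial_coeff_closed S_coeff S_coeff_carrier) auto
    have mult: "(z \<otimes>\<^bsub>S\<^esub> v) k = finsum R (?f v) ?A" if "v \<in> carrier S" for v
      by (intro S_mult z that k S_supp sub subset_refl)
    have "(z \<otimes>\<^bsub>S\<^esub> (x \<oplus>\<^bsub>S\<^esub> y)) k = finsum R (\<lambda>g. ?f x g \<oplus>\<^bsub>R\<^esub> ?f y g) ?A"
      unfolding mult[OF S_add_closed[OF x y]]
    proof (rule R.finsum_cong'[OF refl])
      fix g assume "g \<in> ?A"
      then have "g \<in> carrier G" using sub by auto
      then show "?f (x \<oplus>\<^bsub>S\<^esub> y) g = ?f x g \<oplus>\<^bsub>R\<^esub> ?f y g"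
        using x y z k by (simp add: S_add monomial_coeff_add_right S_coeff S_coeff_carrier)
    qed (intro Pi_I R.a_closed f x y)
    also have "\<dots> = finsum R (?f x) ?A \<oplus>\<^bsub>R\<^esub> finsum R (?f y) ?A"
      by (intro R.finsum_addf Pi_I f x y)
    finally show "(z \<otimes>\<^bsub>S\<^esub> (x \<oplus>\<^bsub>S\<^esub> y)) k = (z \<otimes>\<^bsub>S\<^esub> x \<oplus>\<^bsub>S\<^esub> z \<otimes>\<^bsub>S\<^esub> y) k"
      using k mult x y by (simp add: S_add)
  qed
qed

subsection \<open>Invariant ideals and ideals of the crossed product\<close>

lemma invariant_ideal_\<alpha>:
  assumes "invariant_ideal G R D \<alpha> I" "g \<in> carrier G" "a \<in> I" "a \<in> D (inv g)"
  shows "\<alpha> g a \<in> I"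
  using assms unfolding invariant_ideal_def by blast

text \<open>Invariance speaks only of the forward maps, but \<open>\<alpha> (inv g)\<close> inverts
  \<open>\<alpha> g\<close> up to a unit. With \<open>?w = w (inv g) g\<close> and
  \<open>b = \<alpha> g ?a\<close> one gets
  \<open>?w \<star> ?a = \<alpha> (inv g) b \<star> ?w\<close>, which lies in \<open>I\<close>;
  multiplying by the inverse of \<open>?w\<close> recovers \<open>?a\<close>.\<close>

lemma invariant_ideal_\<beta>:
  assumes I: "invariant_ideal G R D \<alpha> I" and g: "g \<in> carrier G" and b: "b \<in> I" "b \<in> D g"
  shows "\<beta> g b \<in> I"
proof -
  interpret I: ideal I R using I by (simp add: invariant_ideal_def)
  have ig: "inv g \<in> carrier G" using g by simp
  let ?a = "\<beta> g b" and ?w = "w (inv g) g" and ?v = "v (inv g) g"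
  have a: "?a \<in> D (inv g)" "?a \<in> carrier R" using g b by (simp_all add: \<beta>_closed \<beta>_carrier)
  have wv: "?w \<in> carrier R" "?v \<in> carrier R"
    using w_props(1,3)[OF ig g] D_carrier[OF ig] by auto
  have "?w \<star> ?a = \<alpha> (inv g) b \<star> ?w"
    using \<alpha>_comp_w[OF ig g, of ?a] a g b by (simp add: D_one \<alpha>_one \<alpha>_\<beta>)
  also have "\<dots> \<in> I"
    using invariant_ideal_\<alpha>[OF I ig, of b] g b wv by (simp add: I.I_r_closed)
  finally have "?v \<star> (?w \<star> ?a) \<in> I" using wv by (simp add: I.I_l_closed)
  moreover have "?v \<star> (?w \<star> ?a) = ?a"
    using wv a w_props(5)[OF ig g] g ig u_closed by (simp add: u_one D_u_left flip: R.m_assoc)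
  ultimately show ?thesis by simp
qed

text \<open>A left factor in \<open>I\<close> first passes through \<open>\<beta> g\<close>, which
  is where \<open>invariant_ideal_\<beta>\<close> enters.\<close>

lemma monomial_coeff_ideal:
  assumes I: "invariant_ideal G R D \<alpha> I" and g: "g \<in> carrier G" and h: "h \<in> carrier G"
    and a: "a \<in> D g" and b: "b \<in> carrier R" and ab: "a \<in> I \<or> b \<in> I"
  shows "monomial_coeff g h a b \<in> I"
proof -
  interpret I: ideal I R using I by (simp add: invariant_ideal_def)
  have "\<beta> g a \<star> b \<in> I"
    using ab invariant_ideal_\<beta>[OF I g _ a] a b g by (auto simp: I.I_l_closed I.I_r_closed \<beta>_carrier)
  moreover have "\<beta> g a \<star> b \<in> D (inv g)" using a b g by (simp add: D_mult_right \<beta>_closed)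
  ultimately have "\<alpha> g (\<beta> g a \<star> b) \<in> I" by (rule invariant_ideal_\<alpha>[OF I g])
  then show ?thesis using g h by (simp add: monomial_coeff_def I.I_r_closed w_carrier)
qed

definition extended_ideal :: "'a set \<Rightarrow> ('g \<Rightarrow> 'a) set"
  where "extended_ideal I = {x \<in> carrier S. \<forall>g\<in>carrier G. x g \<in> I}"

lemma extended_ideal:
  assumes I: "invariant_ideal G R D \<alpha> I"
  shows "ideal (extended_ideal I) S"
proof -
  interpret S: ring S by (rule S_ring)
  interpret I: ideal I R using I by (simp add: invariant_ideal_def)
  have mult: "x \<otimes>\<^bsub>S\<^esub> y \<in> extended_ideal I"
    if x: "x \<in> carrier S" and y: "y \<in> carrier S" and xy: "x \<in> extended_ideal I \<or> y \<in> extended_ideal I" for x y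
  proof -
    have "(x \<otimes>\<^bsub>S\<^esub> y) k \<in> I" if k: "k \<in> carrier G" for k
    proof -
      have sx: "supp G R x \<subseteq> carrier G" by (auto simp: supp_def)
      have "finsum R (\<lambda>g. monomial_coeff g (inv g \<otimes> k) (x g) (y (inv g \<otimes> k))) (supp G R x) \<in> I"
      proof (rule ideal_finsum[OF I.ideal_axioms])
        fix g assume "g \<in> supp G R x"
        then have "g \<in> carrier G" using sx by auto
        then show "monomial_coeff g (inv g \<otimes> k) (x g) (y (inv g \<otimes> k)) \<in> I"
          using x y xy k unfolding extended_ideal_def
          by (intro monomial_coeff_ideal[OF I]) (auto simp: S_coeff S_coeff_carrier)
      qed
      then show ?thesis using S_mult[OF x y k S_supp[OF x] subset_refl sx] by simp
    qed
    then show ?thesis using x y by (simp add: extended_ideal_def)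
  qed
  show ?thesis
  proof (rule idealI[OF S_ring])
    show "subgroup (extended_ideal I) (add_monoid S)"
    proof (rule S.add.subgroupI)
      have "\<zero>\<^bsub>S\<^esub> \<in> extended_ideal I" by (simp add: extended_ideal_def S_zero)
      then show "extended_ideal I \<noteq> {}" by blast
    next
      fix x assume x: "x \<in> extended_ideal I"
      then have xS: "x \<in> carrier S" by (simp add: extended_ideal_def)
      \<comment> \<open>Negatives come from multiplicative absorption: \<open>-x\<close> is the
        product of \<open>-1\<close> and \<open>x\<close>.\<close>
      have "(\<ominus>\<^bsub>S\<^esub> \<one>\<^bsub>S\<^esub>) \<otimes>\<^bsub>S\<^esub> x \<in> extended_ideal I" by (rule mult) (use x xS in auto)
      then show "\<ominus>\<^bsub>S\<^esub> x \<in> extended_ideal I" using xS by (simp add: S.l_minus)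
    qed (auto simp: extended_ideal_def S_add)
  qed (use mult extended_ideal_def in auto)
qed

text \<open>\<open>I\<close> can be read off from its extension: \<open>delta_one G R i\<close> has
  \<open>i\<close> as coefficient at the identity of \<open>G\<close>, and an extension containing
  the identity of \<open>S\<close> forces the identity of \<open>R\<close> into
  \<open>I\<close>.\<close>

lemma extended_ideal_trivialD:
  assumes I: "invariant_ideal G R D \<alpha> I"
    and J: "extended_ideal I = {\<zero>\<^bsub>S\<^esub>} \<or> extended_ideal I = carrier S"
  shows "I = {\<zero>\<^bsub>R\<^esub>} \<or> I = carrier R"
proof -
  interpret S: ring S by (rule S_ring)
  interpret I: ideal I R using I by (simp add: invariant_ideal_def)
  have delta: "delta_one G R r \<one> = r" for r by (simp add: delta_one_def)
  show ?thesis using J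
  proof
    assume J: "extended_ideal I = {\<zero>\<^bsub>S\<^esub>}"
    have "i = \<zero>\<^bsub>R\<^esub>" if "i \<in> I" for i
    proof -
      have "delta_one G R i \<in> extended_ideal I"
        using that delta_one_closed[of i] by (auto simp: extended_ideal_def I.Icarr delta_one_def)
      then show ?thesis using J delta[of i] S_zero[OF G.one_closed] by simp
    qed
    then show ?thesis using I.zero_closed by auto
  next
    assume "extended_ideal I = carrier S"
    then have "\<one>\<^bsub>S\<^esub> \<one> \<in> I" using S.one_closed unfolding extended_ideal_def by blast
    then show ?thesis using I.one_imp_carrier by (simp add: S_one delta)
  qed
qed

lemma simple_imp_alpha_simple: "simple_ring S \<Longrightarrow> alpha_simple G R D \<alpha>"
  unfolding alpha_simple_def simple_ring_def
  by (intro allI impI extended_ideal_trivialD) (simp_all add: extended_ideal)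

section \<open>Translation of supports and leading ideals\<close>

lemma supp_monomial_right:
  assumes "x \<in> carrier S" "h \<in> carrier G" "c \<in> D h" "k \<in> supp G R (x \<otimes>\<^bsub>S\<^esub> monomial h c)"
  shows "k \<otimes> inv h \<in> supp G R x"
  using assms D_carrier by (auto simp: supp_def S_mult_monomial_right monomial_coeff_zero_left)

lemma supp_monomial_left:
  assumes "x \<in> carrier S" "h \<in> carrier G" "c \<in> D h" "k \<in> supp G R (monomial h c \<otimes>\<^bsub>S\<^esub> x)"
  shows "inv h \<otimes> k \<in> supp G R x"
  using assms by (auto simp: supp_def S_mult_monomial_left monomial_coeff_zero_right)

lemma S_nonzeroD:
  assumes "x \<in> carrier S" "x \<noteq> \<zero>\<^bsub>S\<^esub>"
  obtains g where "g \<in> supp G R x"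
proof -
  have "\<exists>g. g \<in> supp G R x"
  proof (rule ccontr)
    assume "\<not> ?thesis"
    then have "x = \<zero>\<^bsub>S\<^esub>"
      by (intro S_eqI S_carrier_extensional[OF assms(1)] S_extensional) (auto simp: supp_def S_zero)
    then show False using assms by simp
  qed
  then show ?thesis using that by blast
qed

text \<open>Supports are bounded by \<open>T\<close> rather than required to equal it, so that sums
  and multiples by elements of \<open>R\<close> still satisfy the condition.\<close>

definition leading_ideal :: "('g \<Rightarrow> 'a) set \<Rightarrow> 'g set \<Rightarrow> 'a set"
  where "leading_ideal J T = {z \<one> | z. z \<in> J \<and> supp G R z \<subseteq> T}"

text \<open>
  The image under \<open>\<alpha>\<^sub>h\<close> of the identity coefficient of \<open>z\<close> is the identity
  coefficient of \<open>(u\<^sub>h \<delta>\<^sub>h) z (c \<delta>\<^sub>h\<inverse>)\<close> with \<open>\<alpha>\<^sub>h(c) = w\<^sub>h\<^sub>,\<^sub>h\<inverse>\<inverse>\<close>; as \<open>G\<close> is abelian, this product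
  is still supported in \<open>T\<close>.
\<close>

lemma leading_ideal_invariant:
  assumes comm: "comm_group G" and J: "ideal J S"
  shows "invariant_ideal G R D \<alpha> (leading_ideal J T)"
proof -
  interpret S: ring S by (rule S_ring)
  interpret J: ideal J S by (rule J)
  let ?L = "leading_ideal J T"
  have LI: "z \<one> \<in> ?L" if "z \<in> J" "supp G R z \<subseteq> T" for z
    using that unfolding leading_ideal_def by blast
  have LE: "\<exists>z. z \<in> J \<and> z \<in> carrier S \<and> supp G R z \<subseteq> T \<and> a = z \<one>" if "a \<in> ?L" for a
    using that J.Icarr unfolding leading_ideal_def by blast
  have supp_subset: "supp G R y \<subseteq> T" if "supp G R z \<subseteq> T" "\<And>k. k \<in> carrier G \<Longrightarrow> z k = \<zero>\<^bsub>R\<^esub> \<Longrightarrow> y k = \<zero>\<^bsub>R\<^esub>" for y z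
    using that by (auto simp: supp_def)
  have l_closed: "r \<star> a \<in> ?L" if a: "a \<in> ?L" and r: "r \<in> carrier R" for r a
  proof -
    obtain z where z: "z \<in> J" "z \<in> carrier S" "supp G R z \<subseteq> T" "a = z \<one>" using LE[OF a] by blast
    have "supp G R (delta_one G R r \<otimes>\<^bsub>S\<^esub> z) \<subseteq> T"
      by (rule supp_subset[OF z(3)]) (simp add: S_mult_delta_left z r)
    then have "(delta_one G R r \<otimes>\<^bsub>S\<^esub> z) \<one> \<in> ?L"
      using z r by (intro LI J.I_l_closed delta_one_closed)
    then show ?thesis using z r by (simp add: S_mult_delta_left)
  qed
  have r_closed: "a \<star> r \<in> ?L" if a: "a \<in> ?L" and r: "r \<in> carrier R" for r a
  proof -
    obtain z where z: "z \<in> J" "z \<in> carrier S" "supp G R z \<subseteq> T" "a = z \<one>" using LE[OF a] by blast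
    have "supp G R (z \<otimes>\<^bsub>S\<^esub> delta_one G R r) \<subseteq> T"
      by (rule supp_subset[OF z(3)]) (simp add: S_mult_delta_right z r \<beta>_zero \<alpha>_zero)
    then have "(z \<otimes>\<^bsub>S\<^esub> delta_one G R r) \<one> \<in> ?L"
      using z r by (intro LI J.I_r_closed delta_one_closed)
    then show ?thesis using z r by (simp add: S_mult_delta_right_one)
  qed
  have carr: "?L \<subseteq> carrier R" using LE S_coeff_carrier by blast
  have "ideal ?L R"
  proof (rule idealI[OF R.ring_axioms])
    show "subgroup ?L (add_monoid R)"
    proof (rule R.add.subgroupI)
      have "\<zero>\<^bsub>S\<^esub> \<one> \<in> ?L" by (rule LI) (auto simp: supp_def S_zero)
      then show "?L \<noteq> {}" by blast
    next
      fix a assume a: "a \<in> ?L"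
      then have "(\<ominus>\<^bsub>R\<^esub> \<one>\<^bsub>R\<^esub>) \<star> a \<in> ?L" by (intro l_closed) auto
      then show "\<ominus>\<^bsub>R\<^esub> a \<in> ?L" using a carr by (auto simp: R.l_minus)
    next
      fix a b assume "a \<in> ?L" "b \<in> ?L"
      then obtain y z where yz: "y \<in> J" "supp G R y \<subseteq> T" "a = y \<one>" "z \<in> J" "supp G R z \<subseteq> T" "b = z \<one>"
        using LE by meson
      have "supp G R (y \<oplus>\<^bsub>S\<^esub> z) \<subseteq> supp G R y \<union> supp G R z" by (auto simp: supp_def S_add)
      then have "supp G R (y \<oplus>\<^bsub>S\<^esub> z) \<subseteq> T" using yz by blast
      then have "(y \<oplus>\<^bsub>S\<^esub> z) \<one> \<in> ?L" using yz by (intro LI J.a_closed)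
      then show "a \<oplus>\<^bsub>R\<^esub> b \<in> ?L" using yz by (simp add: S_add)
    qed (rule carr)
  qed (fact l_closed r_closed)+
  moreover have "\<alpha> h a \<in> ?L" if h: "h \<in> carrier G" and a: "a \<in> ?L" and aD: "a \<in> D (inv h)" for h a
  proof -
    obtain z where z: "z \<in> J" "z \<in> carrier S" "supp G R z \<subseteq> T" "a = z \<one>" using LE[OF a] by blast
    have ih: "inv h \<in> carrier G" using h by simp
    note wv = w_props[OF h ih]
    define c where "c = \<beta> h (v h (inv h))"
    have c: "c \<in> D (inv h)" "\<alpha> h c = v h (inv h)"
      using wv(3) h by (simp_all add: c_def \<beta>_closed \<alpha>_\<beta>)
    define y where "y = monomial h (u h) \<otimes>\<^bsub>S\<^esub> z"
    have y: "y \<in> J" "y \<in> carrier S"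
      unfolding y_def using z h by (simp_all add: J.I_l_closed monomial_closed u_in_D)
    \<comment> \<open>Left multiplication by \<open>u\<^sub>h \<delta>\<^sub>h\<close> moves the
      identity coefficient \<open>a\<close> of \<open>z\<close> to position \<open>h\<close> and
      applies \<open>\<alpha> h\<close> to it.\<close>
    have yh: "y h = \<alpha> h a"
      unfolding y_def using z h aD \<alpha>_closed[OF h aD]
      by (simp add: S_mult_monomial_left u_in_D monomial_coeff_def \<beta>_u w_one_right D_u_left D_u_right)
    let ?q = "y \<otimes>\<^bsub>S\<^esub> monomial (inv h) c"
    have q: "?q \<in> J" using y c ih by (simp add: J.I_r_closed monomial_closed)
    have "supp G R ?q \<subseteq> T"
    proof
      fix k assume k: "k \<in> supp G R ?q"
      then have kG: "k \<in> carrier G" by (simp add: supp_def)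
      have "k \<otimes> h \<in> supp G R y" using supp_monomial_right[OF y(2) ih c(1) k] h by simp
      then have "inv h \<otimes> (k \<otimes> h) \<in> supp G R z"
        unfolding y_def by (rule supp_monomial_left[OF z(2) h u_in_D[OF h]])
      moreover have "inv h \<otimes> (k \<otimes> h) = k"
        using comm_monoid.m_comm[OF comm_group.axioms(1)[OF comm] kG h] kG h by (simp add: inv_mult_cancel)
      ultimately show "k \<in> T" using z by auto
    qed
    then have "?q \<one> \<in> ?L" by (rule LI[OF q])
    moreover have "?q \<one> = \<alpha> h (a \<star> c) \<star> w h (inv h)"
      using S_mult_monomial_right[OF y(2) ih c(1) G.one_closed] h yh aD
      by (simp add: monomial_coeff_def \<beta>_\<alpha>)
    moreover have "\<dots> = \<alpha> h a"
    proof -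
      have carr': "\<alpha> h a \<in> carrier R" "v h (inv h) \<in> carrier R" "w h (inv h) \<in> carrier R"
        using aD h wv D_carrier \<alpha>_carrier by auto
      then have "\<alpha> h (a \<star> c) \<star> w h (inv h) = \<alpha> h a \<star> (v h (inv h) \<star> w h (inv h))"
        using aD c h by (simp add: \<alpha>_mult R.m_assoc)
      also have "\<dots> = \<alpha> h a"
        using wv(5) h aD carr' u_closed by (simp add: u_one D_u_right \<alpha>_closed)
      finally show ?thesis .
    qed
    ultimately show ?thesis by simp
  qed
  ultimately show ?thesis using \<alpha>_closed unfolding invariant_ideal_def by blast
qed

section \<open>An element of minimal support that centralizes \<open>R\<close>\<close>

lemma minimal_support_central:
  assumes comm: "comm_group G" and simple: "alpha_simple G R D \<alpha>"
    and J: "ideal J S" and J0: "J \<noteq> {\<zero>\<^bsub>S\<^esub>}"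
  obtains z where "z \<in> J" "z \<in> centralizer S (delta_one G R ` carrier R)" "z \<noteq> \<zero>\<^bsub>S\<^esub>"
proof -
  interpret S: ring S by (rule S_ring)
  interpret J: ideal J S by (rule J)
  obtain x0 where "x0 \<in> J" "x0 \<noteq> \<zero>\<^bsub>S\<^esub>" using J0 J.zero_closed by blast
  then obtain x where x: "x \<in> J" "x \<noteq> \<zero>\<^bsub>S\<^esub>"
    and least: "\<And>y. y \<in> J \<Longrightarrow> y \<noteq> \<zero>\<^bsub>S\<^esub> \<Longrightarrow> card (supp G R x) \<le> card (supp G R y)"
    using ex_has_least_nat[of "\<lambda>x. x \<in> J \<and> x \<noteq> \<zero>\<^bsub>S\<^esub>" x0 "\<lambda>x. card (supp G R x)"] by blast
  have xS: "x \<in> carrier S" using x J.Icarr by blast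
  obtain g where gx: "g \<in> supp G R x" using S_nonzeroD[OF xS x(2)] by blast
  then have g: "g \<in> carrier G" and xg: "x g \<noteq> \<zero>\<^bsub>R\<^esub>" by (auto simp: supp_def)
  have ig: "inv g \<in> carrier G" using g by simp
  \<comment> \<open>Right translation by \<open>inv g\<close> moves position \<open>g\<close> to the
    identity of \<open>G\<close>. The coefficient there is \<open>x g \<star> w g (inv g)\<close>,
    which is nonzero because \<open>w g (inv g)\<close> is invertible in \<open>D g\<close>.\<close>
  define y where "y = x \<otimes>\<^bsub>S\<^esub> monomial (inv g) (u (inv g))"
  have y: "y \<in> J" "y \<in> carrier S"
    unfolding y_def using x xS ig by (simp_all add: J.I_r_closed monomial_closed u_in_D)
  let ?T = "supp G R y"
  have xgD: "x g \<in> D g" "x g \<in> carrier R" using S_coeff S_coeff_carrier xS g by auto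
  have y1: "y \<one> = x g \<star> w g (inv g)"
    unfolding y_def using S_mult_monomial_right[OF xS ig u_in_D[OF ig] G.one_closed] g xgD
    by (simp add: monomial_coeff_def D_u_right \<beta>_closed \<alpha>_\<beta>)
  have "y \<one> \<noteq> \<zero>\<^bsub>R\<^esub>"
  proof
    assume "y \<one> = \<zero>\<^bsub>R\<^esub>"
    moreover have wv: "w g (inv g) \<in> carrier R" "v g (inv g) \<in> carrier R"
      using w_props(1,3)[OF g ig] D_carrier[OF g] by auto
    ultimately have "x g \<star> (w g (inv g) \<star> v g (inv g)) = \<zero>\<^bsub>R\<^esub>"
      using y1 xgD by (simp flip: R.m_assoc)
    then show False using w_props(6)[OF g ig] xg xgD g u_closed by (simp add: u_one D_u_right)
  qed
  then have one_T: "\<one> \<in> ?T" and y1_neq: "y \<one> \<noteq> \<zero>\<^bsub>R\<^esub>" by (simp_all add: supp_def)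
  \<comment> \<open>The map \<open>k \<mapsto> k g\<close> embeds the support of \<open>y\<close>
    into that of \<open>x\<close>, so the support of \<open>y\<close> has minimal size as
    well.\<close>
  have "card ?T \<le> card (supp G R x)"
  proof (rule card_inj_on_le[of "\<lambda>k. k \<otimes> g"])
    show "inj_on (\<lambda>k. k \<otimes> g) ?T" using g by (auto intro!: inj_onI simp: supp_def)
    show "(\<lambda>k. k \<otimes> g) ` ?T \<subseteq> supp G R x"
      using supp_monomial_right[OF xS ig u_in_D[OF ig]] g unfolding y_def by auto
  qed (rule S_supp[OF xS])
  then have least_T: "card ?T \<le> card (supp G R z)" if "z \<in> J" "z \<noteq> \<zero>\<^bsub>S\<^esub>" for z
    using least[OF that] by simp
  have "leading_ideal J ?T = {\<zero>\<^bsub>R\<^esub>} \<or> leading_ideal J ?T = carrier R"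
    using simple leading_ideal_invariant[OF comm J] unfolding alpha_simple_def by blast
  moreover have "y \<one> \<in> leading_ideal J ?T" using y unfolding leading_ideal_def by blast
  ultimately have "\<one>\<^bsub>R\<^esub> \<in> leading_ideal J ?T" using y1_neq by auto
  then obtain z where z: "z \<in> J" "supp G R z \<subseteq> ?T" and z1: "z \<one> = \<one>\<^bsub>R\<^esub>"
    unfolding leading_ideal_def by force
  have zS: "z \<in> carrier S" using z J.Icarr by blast
  have "z \<otimes>\<^bsub>S\<^esub> delta_one G R r = delta_one G R r \<otimes>\<^bsub>S\<^esub> z" if r: "r \<in> carrier R" for r
  proof (rule ccontr)
    assume neq: "\<not> ?thesis"
    let ?d = "delta_one G R r"
    have d: "?d \<in> carrier S" by (rule delta_one_closed[OF r])
    let ?q = "z \<otimes>\<^bsub>S\<^esub> ?d \<ominus>\<^bsub>S\<^esub> ?d \<otimes>\<^bsub>S\<^esub> z"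
    have q: "?q \<in> J" using z d by (simp add: J.I_l_closed J.I_r_closed a_minus_def)
    have qS: "?q \<in> carrier S" using q J.Icarr by blast
    \<comment> \<open>Writing the commutator relation additively lets its coefficients be compared
      by the formulas for sums and products.\<close>
    have qadd: "?q \<oplus>\<^bsub>S\<^esub> ?d \<otimes>\<^bsub>S\<^esub> z = z \<otimes>\<^bsub>S\<^esub> ?d"
      using zS d by (simp add: a_minus_def S.a_assoc S.l_neg)
    have "?q \<noteq> \<zero>\<^bsub>S\<^esub>"
      using qadd neq zS d by auto
    then have le: "card ?T \<le> card (supp G R ?q)" by (rule least_T[OF q])
    have coeff: "?q k \<oplus>\<^bsub>R\<^esub> r \<star> z k = \<alpha> k (\<beta> k (z k) \<star> r)" if "k \<in> carrier G" for k
      using arg_cong[OF qadd, of "\<lambda>f. f k"] that zS r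
      by (simp add: S_add S_mult_delta_left S_mult_delta_right)
    \<comment> \<open>As \<open>z\<close> has identity coefficient 1, both \<open>z r\<close> and
      \<open>r z\<close> have coefficient \<open>r\<close> there. The commutator thus loses this
      position and, as shown next, gains none outside \<open>?T\<close>.\<close>
    have "?q \<one> \<oplus>\<^bsub>R\<^esub> r = r"
      using arg_cong[OF qadd, of "\<lambda>f. f \<one>"] zS r z1
      by (simp add: S_add S_mult_delta_left S_mult_delta_right_one)
    then have q1: "?q \<one> = \<zero>\<^bsub>R\<^esub>"
      using r qS by (simp add: S_coeff_carrier)
    have "?q k = \<zero>\<^bsub>R\<^esub>" if k: "k \<in> carrier G" and "k \<notin> ?T" for k
    proof -
      have "z k = \<zero>\<^bsub>R\<^esub>" using z that by (auto simp: supp_def)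
      then show ?thesis using coeff[OF k] k r qS by (simp add: \<beta>_zero \<alpha>_zero S_coeff_carrier)
    qed
    then have "supp G R ?q \<subset> ?T" using q1 one_T by (auto simp: supp_def)
    then have "card (supp G R ?q) < card ?T" by (intro psubset_card_mono S_supp y)
    then show False using le by simp
  qed
  then have "z \<in> centralizer S (delta_one G R ` carrier R)" using zS by (auto simp: centralizer_def)
  moreover have "z \<noteq> \<zero>\<^bsub>S\<^esub>"
  proof
    assume "z = \<zero>\<^bsub>S\<^esub>"
    then have "\<one>\<^bsub>R\<^esub> = \<zero>\<^bsub>R\<^esub>" using z1 S_zero[OF G.one_closed] by simp
    then have "carrier R = {\<zero>\<^bsub>R\<^esub>}" by (rule R.one_zeroD)
    then show False using y1_neq S_coeff_carrier[OF y(2) G.one_closed] by simp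
  qed
  ultimately show ?thesis using that z by blast
qed

section \<open>Reduction to the simple centralizer\<close>

lemma alpha_simple_imp_simple:
  assumes comm: "comm_group G" and simple: "alpha_simple G R D \<alpha>"
    and C: "simple_ring (S\<lparr>carrier := centralizer S (delta_one G R ` carrier R)\<rparr>)"
  shows "simple_ring S"
proof -
  interpret S: ring S by (rule S_ring)
  let ?C = "centralizer S (delta_one G R ` carrier R)"
  let ?SC = "S\<lparr>carrier := ?C\<rparr>"
  \<comment> \<open>\<open>simple_ring\<close> includes the ring axioms, so closure of the
    centralizer under the operations comes with the hypothesis.\<close>
  interpret C: ring ?SC using C by (simp add: simple_ring_def)
  have CS: "?C \<subseteq> carrier S" by (auto simp: centralizer_def)
  have C0: "\<zero>\<^bsub>S\<^esub> \<in> ?C" and C1: "\<one>\<^bsub>S\<^esub> \<in> ?C" using C.zero_closed C.one_closed by simp_all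
  have "J = {\<zero>\<^bsub>S\<^esub>} \<or> J = carrier S" if J: "ideal J S" for J
  proof (rule disjCI)
    assume "J \<noteq> carrier S"
    interpret J: ideal J S by (rule J)
    show "J = {\<zero>\<^bsub>S\<^esub>}"
    proof (rule ccontr)
      assume "J \<noteq> {\<zero>\<^bsub>S\<^esub>}"
      then obtain z where z: "z \<in> J" "z \<in> ?C" "z \<noteq> \<zero>\<^bsub>S\<^esub>"
        using minimal_support_central[OF comm simple J] by blast
      have "ideal (J \<inter> ?C) ?SC"
      proof (rule idealI[OF C.ring_axioms])
        show "subgroup (J \<inter> ?C) (add_monoid ?SC)"
        proof (rule C.add.subgroupI)
          show "J \<inter> ?C \<noteq> {}" using z by blast
        next
          fix a assume a: "a \<in> J \<inter> ?C"
          \<comment> \<open>The additive inverse in \<open>?SC\<close> is formed relative to the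
            smaller carrier, so it is not literally the one of \<open>S\<close>. Writing it as a
            product with \<open>-1\<close> puts it into \<open>J\<close>.\<close>
          have m1: "\<ominus>\<^bsub>?SC\<^esub> \<one>\<^bsub>?SC\<^esub> \<in> ?C" using C.a_inv_closed[OF C.one_closed] by simp
          have "\<ominus>\<^bsub>?SC\<^esub> a = (\<ominus>\<^bsub>?SC\<^esub> \<one>\<^bsub>?SC\<^esub>) \<otimes>\<^bsub>?SC\<^esub> a"
            using C.l_minus[of "\<one>\<^bsub>?SC\<^esub>" a] a C.l_one[of a] C.one_closed by simp
          moreover have "(\<ominus>\<^bsub>?SC\<^esub> \<one>\<^bsub>?SC\<^esub>) \<otimes>\<^bsub>?SC\<^esub> a \<in> J"
            using J.I_l_closed[of a "\<ominus>\<^bsub>?SC\<^esub> \<one>\<^bsub>?SC\<^esub>"] a m1 CS by auto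
          moreover have "\<ominus>\<^bsub>?SC\<^esub> a \<in> ?C" using C.a_inv_closed[of a] a by simp
          ultimately show "\<ominus>\<^bsub>?SC\<^esub> a \<in> J \<inter> ?C" by simp
        next
          fix a b assume "a \<in> J \<inter> ?C" "b \<in> J \<inter> ?C"
          then show "a \<oplus>\<^bsub>?SC\<^esub> b \<in> J \<inter> ?C" using C.a_closed[of a b] J.a_closed[of a b] by simp
        qed simp
      next
        fix a b assume "a \<in> J \<inter> ?C" "b \<in> carrier ?SC"
        then show "b \<otimes>\<^bsub>?SC\<^esub> a \<in> J \<inter> ?C" "a \<otimes>\<^bsub>?SC\<^esub> b \<in> J \<inter> ?C"
          using C.m_closed[of a b] C.m_closed[of b a] J.I_l_closed[of a b] J.I_r_closed[of a b] CS by auto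
      qed
      \<comment> \<open>The intersection contains the nonzero \<open>z\<close>, so simplicity leaves
        only the whole centralizer, which contains the identity of \<open>S\<close>.\<close>
      then have "J \<inter> ?C = {\<zero>\<^bsub>S\<^esub>} \<or> J \<inter> ?C = ?C"
        using C by (simp add: simple_ring_def)
      then have "\<one>\<^bsub>S\<^esub> \<in> J" using z C1 by blast
      then show False using J.one_imp_carrier \<open>J \<noteq> carrier S\<close> by blast
    qed
  qed
  moreover have "carrier S \<noteq> {\<zero>\<^bsub>S\<^esub>}"
    using C CS C0 unfolding simple_ring_def by auto
  ultimately show ?thesis using S_ring by (auto simp: simple_ring_def)
qed

end

theorem theorem2p22:
  fixes G :: "('g, 'n) monoid_scheme"
    and R :: "('a, 'm) ring_scheme"
    and D :: "'g \<Rightarrow> 'a set"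
    and u :: "'g \<Rightarrow> 'a"
    and \<alpha> :: "'g \<Rightarrow> 'a \<Rightarrow> 'a"
    and w :: "'g \<Rightarrow> 'g \<Rightarrow> 'a"
  assumes "twisted_partial_action G R D u \<alpha> w"
    and "comm_group G"
    and "simple_ring ((partial_crossed_product G R D \<alpha> w)
      \<lparr>carrier := centralizer (partial_crossed_product G R D \<alpha> w) (delta_one G R ` carrier R)\<rparr>)"
  shows "simple_ring (partial_crossed_product G R D \<alpha> w) \<longleftrightarrow> alpha_simple G R D \<alpha>"
proof -
  interpret twisted_partial_action G R D u \<alpha> w by fact
  show ?thesis using simple_imp_alpha_simple alpha_simple_imp_simple assms(2,3) by blast
qed

end
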